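(* Let $(\mathbf{T}(t))_{t\ge0}$ be a Markov semigroup on $\mathcal{C}(\mathcal{Z})$ with stationary probability measure $\mu$, and let $(\mathbf{A},\mathcal{D}(\mathbf{A}))$ denote the generator of its extension to $L^2(\mu)$. Assume that $\mathbf{A}$ is normal on $L^2(\mu)$ and let $g\in\mathcal{D}(\mathbf{A}^\infty)$. Write $\mathrm{E}_n(g):=\mathrm{E}_n(g,g)$. Then: 1. The sequence $(\mathrm{E}_n(g))_{n\in\mathbb{N}}$ is log-convex, i.e. for all integers $n\ge1$ we have $\mathrm{E}_{n+1}(g)\,\mathrm{E}_{n-1}(g)\ge\mathrm{E}_n(g)^2$. 2. If $\mathrm{E}_0(g)>0$, then for all integers $n\ge1$ $$\left(\frac{\mathrm{E}_{n+1}(g)}{\mathrm{E}_0(g)}\right)^{\frac{1}{n+1}}\ge\left(\frac{\mathrm{E}_n(g)}{\mathrm{E}_0(g)}\right)^{\frac1n}.$$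
   Context: $\mathbb{N}=\{0,1,2,\dots\}$. $\mathcal{Z}$ is a compact metrizable topological space; $\mathcal{C}(\mathcal{Z})$ is the space of real-valued continuous functions on $\mathcal{Z}$ with the supremum norm and pointwise order; $\mathbf{1}$ is the constant function one. A Markov operator is a bounded linear operator $\mathbf{M}$ on $\mathcal{C}(\mathcal{Z})$ with $\mathbf{M}\mathbf{1}=\mathbf{1}$ and $\mathbf{M}g\ge0$ whenever $g\ge0$. A Markov semigroup $(\mathbf{T}(t))_{t\ge0}$ is a strongly continuous semigroup of Markov operators on $\mathcal{C}(\mathcal{Z})$. A stationary probability measure is a Borel probability measure $\mu$ on $\mathcal{Z}$ with $\int\mathbf{T}(t)g\,\mathrm{d}\mu=\int g\,\mathrm{d}\mu$ for all $g\in\mathcal{C}(\mathcal{Z})$ and $t\ge0$. $L^2(\mu)$ is the real Hilbert space with scalar product $(f,g)_\mu=\int_{\mathcal{Z}}f g\,\mathrm{d}\mu$ and norm $\|\cdot\|_\mu$. The semigroup $\mathbf{T}(t)$ extends to a strongly continuous contraction semigroup on $L^2(\mu)$; its generator on $L^2(\mu)$ is denoted $(\mathbf{A},\mathcal{D}(\mathbf{A}))$ with $\mathcal{D}(\mathbf{A})\subset L^2(\mu)$, and $\mathcal{D}(\mathbf{A}^\infty)=\bigcap_n\mathcal{D}(\mathbf{A}^n)$. Let $\mathbf{A}^\star$ be the $L^2(\mu)$-adjoint of $\mathbf{A}$. $\mathbf{A}$ is normal if $\mathcal{D}(\mathbf{A})=\mathcal{D}(\mathbf{A}^\star)$ and $\|\mathbf{A}g\|_\mu=\|\mathbf{A}^\star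 g\|_\mu$ for all $g\in\mathcal{D}(\mathbf{A})$. Energies: $\mathrm{E}_0(f,g)=(f,g)_\mu-(f,\mathbf{1})_\mu(g,\mathbf{1})_\mu$ and $\mathrm{E}_{n+1}(f,g)=-\mathrm{E}_n(\mathbf{A}f,g)-\mathrm{E}_n(f,\mathbf{A}g)$. *)

theory Defs
  imports "HOL-Probability.Probability_Measure"
begin

text \<open>On a compact space every continuous real function is bounded, so the library type
  \<open>'z \<Rightarrow>\<^sub>C real\<close> of bounded continuous functions, with its supremum norm, is \<open>C(Z)\<close>;
  bounded linear operators on it are elements of the library type \<open>_ \<Rightarrow>\<^sub>L _\<close>.\<close>

definition markov_operator ::
    "(('z::topological_space \<Rightarrow>\<^sub>C real) \<Rightarrow>\<^sub>L ('z \<Rightarrow>\<^sub>C real)) \<Rightarrow> bool" where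
  "markov_operator P \<longleftrightarrow>
     blinfun_apply P (const_bcontfun 1) = const_bcontfun 1 \<and>
     (\<forall>g. (\<forall>x. 0 \<le> apply_bcontfun g x) \<longrightarrow>
          (\<forall>x. 0 \<le> apply_bcontfun (blinfun_apply P g) x))"

definition markov_semigroup ::
    "(real \<Rightarrow> (('z::topological_space \<Rightarrow>\<^sub>C real) \<Rightarrow>\<^sub>L ('z \<Rightarrow>\<^sub>C real))) \<Rightarrow> bool" where
  "markov_semigroup T \<longleftrightarrow>
     (\<forall>t\<ge>0. markov_operator (T t)) \<and>
     T 0 = id_blinfun \<and>
     (\<forall>s\<ge>0. \<forall>t\<ge>0. T (s + t) = T s o\<^sub>L T t) \<and>
     (\<forall>g. continuous_on {0..} (\<lambda>t. blinfun_apply (T t) g))"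

definition stationary_prob ::
    "(real \<Rightarrow> (('z::topological_space \<Rightarrow>\<^sub>C real) \<Rightarrow>\<^sub>L ('z \<Rightarrow>\<^sub>C real))) \<Rightarrow> 'z measure \<Rightarrow> bool" where
  "stationary_prob T \<mu> \<longleftrightarrow>
     prob_space \<mu> \<and> sets \<mu> = sets borel \<and>
     (\<forall>g. \<forall>t\<ge>0. (\<integral>x. apply_bcontfun (blinfun_apply (T t) g) x \<partial>\<mu>) = (\<integral>x. apply_bcontfun g x \<partial>\<mu>))"


text \<open>Elements of \<open>L\<^sup>2(\<mu>)\<close> are handled through representatives: \<open>L2 \<mu>\<close> consists of the
  square-integrable functions, and equality in \<open>L\<^sup>2(\<mu>)\<close> is equality almost everywhere.
  An operator on \<open>L\<^sup>2(\<mu>)\<close> returns some representative of the value (chosen by \<open>SOME\<close>);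
  which one is immaterial, as operators are only inspected through their domains, through
  \<open>L2_inner\<close> and \<open>L2_norm\<close>, and through limits in \<open>L2_norm\<close>.\<close>

definition L2 :: "'z measure \<Rightarrow> ('z \<Rightarrow> real) set" where
  "L2 \<mu> = {f \<in> borel_measurable \<mu>. integrable \<mu> (\<lambda>x. (f x)\<^sup>2)}"

definition L2_inner :: "'z measure \<Rightarrow> ('z \<Rightarrow> real) \<Rightarrow> ('z \<Rightarrow> real) \<Rightarrow> real" where
  "L2_inner \<mu> f g = (\<integral>x. f x * g x \<partial>\<mu>)"

definition L2_norm :: "'z measure \<Rightarrow> ('z \<Rightarrow> real) \<Rightarrow> real" where
  "L2_norm \<mu> f = sqrt (L2_inner \<mu> f f)"

definition L2_tendsto ::
    "'z measure \<Rightarrow> ('b \<Rightarrow> 'z \<Rightarrow> real) \<Rightarrow> ('z \<Rightarrow> real) \<Rightarrow> 'b filter \<Rightarrow> bool" where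
  "L2_tendsto \<mu> u f F \<longleftrightarrow> ((\<lambda>b. L2_norm \<mu> (\<lambda>x. u b x - f x)) \<longlongrightarrow> 0) F"

text \<open>The continuous extension to \<open>L\<^sup>2(\<mu>)\<close> of an operator \<open>P\<close> on \<open>C(Z)\<close>: approximate
  \<open>f \<in> L\<^sup>2(\<mu>)\<close> by continuous functions \<open>u n\<close> and take the \<open>L\<^sup>2\<close>-limit of \<open>P (u n)\<close>.\<close>

definition L2_extension ::
    "'z::topological_space measure \<Rightarrow> (('z \<Rightarrow>\<^sub>C real) \<Rightarrow>\<^sub>L ('z \<Rightarrow>\<^sub>C real)) \<Rightarrow>
     ('z \<Rightarrow> real) \<Rightarrow> ('z \<Rightarrow> real)" where
  "L2_extension \<mu> P f = (SOME h. h \<in> L2 \<mu> \<and>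
     (\<exists>u :: nat \<Rightarrow> ('z \<Rightarrow>\<^sub>C real).
        L2_tendsto \<mu> (\<lambda>n. apply_bcontfun (u n)) f sequentially \<and>
        L2_tendsto \<mu> (\<lambda>n. apply_bcontfun (blinfun_apply P (u n))) h sequentially))"


definition is_generator_value ::
    "'z measure \<Rightarrow> (real \<Rightarrow> ('z \<Rightarrow> real) \<Rightarrow> ('z \<Rightarrow> real)) \<Rightarrow> ('z \<Rightarrow> real) \<Rightarrow> ('z \<Rightarrow> real) \<Rightarrow> bool" where
  "is_generator_value \<mu> S f h \<longleftrightarrow> f \<in> L2 \<mu> \<and> h \<in> L2 \<mu> \<and>
     L2_tendsto \<mu> (\<lambda>t x. (S t f x - f x) / t) h (at_right 0)"

definition generator_dom ::
    "'z measure \<Rightarrow> (real \<Rightarrow> ('z \<Rightarrow> real) \<Rightarrow> ('z \<Rightarrow> real)) \<Rightarrow> ('z \<Rightarrow> real) set" where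
  "generator_dom \<mu> S = {f. \<exists>h. is_generator_value \<mu> S f h}"

definition generator ::
    "'z measure \<Rightarrow> (real \<Rightarrow> ('z \<Rightarrow> real) \<Rightarrow> ('z \<Rightarrow> real)) \<Rightarrow> ('z \<Rightarrow> real) \<Rightarrow> ('z \<Rightarrow> real)" where
  "generator \<mu> S f = (SOME h. is_generator_value \<mu> S f h)"


text \<open>Unbounded operators on \<open>L\<^sup>2(\<mu>)\<close>: a domain \<open>D\<close> together with a map \<open>A\<close>.\<close>

definition is_adjoint_value ::
    "'z measure \<Rightarrow> ('z \<Rightarrow> real) set \<Rightarrow> (('z \<Rightarrow> real) \<Rightarrow> ('z \<Rightarrow> real)) \<Rightarrow>
     ('z \<Rightarrow> real) \<Rightarrow> ('z \<Rightarrow> real) \<Rightarrow> bool" where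
  "is_adjoint_value \<mu> D A f h \<longleftrightarrow> f \<in> L2 \<mu> \<and> h \<in> L2 \<mu> \<and>
     (\<forall>g\<in>D. L2_inner \<mu> (A g) f = L2_inner \<mu> g h)"

definition adjoint_dom ::
    "'z measure \<Rightarrow> ('z \<Rightarrow> real) set \<Rightarrow> (('z \<Rightarrow> real) \<Rightarrow> ('z \<Rightarrow> real)) \<Rightarrow> ('z \<Rightarrow> real) set" where
  "adjoint_dom \<mu> D A = {f. \<exists>h. is_adjoint_value \<mu> D A f h}"

definition adjoint_op ::
    "'z measure \<Rightarrow> ('z \<Rightarrow> real) set \<Rightarrow> (('z \<Rightarrow> real) \<Rightarrow> ('z \<Rightarrow> real)) \<Rightarrow>
     ('z \<Rightarrow> real) \<Rightarrow> ('z \<Rightarrow> real)" where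
  "adjoint_op \<mu> D A f = (SOME h. is_adjoint_value \<mu> D A f h)"

definition normal_op ::
    "'z measure \<Rightarrow> ('z \<Rightarrow> real) set \<Rightarrow> (('z \<Rightarrow> real) \<Rightarrow> ('z \<Rightarrow> real)) \<Rightarrow> bool" where
  "normal_op \<mu> D A \<longleftrightarrow> D = adjoint_dom \<mu> D A \<and>
     (\<forall>g\<in>D. L2_norm \<mu> (A g) = L2_norm \<mu> (adjoint_op \<mu> D A g))"

primrec dom_pow ::
    "'z measure \<Rightarrow> ('z \<Rightarrow> real) set \<Rightarrow> (('z \<Rightarrow> real) \<Rightarrow> ('z \<Rightarrow> real)) \<Rightarrow> nat \<Rightarrow> ('z \<Rightarrow> real) set" where
  "dom_pow \<mu> D A 0 = L2 \<mu>"
| "dom_pow \<mu> D A (Suc n) = {f \<in> D. A f \<in> dom_pow \<mu> D A n}"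

definition dom_infty ::
    "'z measure \<Rightarrow> ('z \<Rightarrow> real) set \<Rightarrow> (('z \<Rightarrow> real) \<Rightarrow> ('z \<Rightarrow> real)) \<Rightarrow> ('z \<Rightarrow> real) set" where
  "dom_infty \<mu> D A = (\<Inter>n. dom_pow \<mu> D A n)"

primrec energy ::
    "'z measure \<Rightarrow> (('z \<Rightarrow> real) \<Rightarrow> ('z \<Rightarrow> real)) \<Rightarrow> nat \<Rightarrow> ('z \<Rightarrow> real) \<Rightarrow> ('z \<Rightarrow> real) \<Rightarrow> real" where
  "energy \<mu> A 0 = (\<lambda>f g. L2_inner \<mu> f g - L2_inner \<mu> f (\<lambda>_. 1) * L2_inner \<mu> g (\<lambda>_. 1))"
| "energy \<mu> A (Suc n) = (\<lambda>f g. - energy \<mu> A n (A f) g - energy \<mu> A n f (A g))"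

end

theory Submission
  imports Defs
begin

text \<open>Put \<open>G = -(A + A\<^sup>*)\<close>. Since \<open>A\<close> is normal, \<open>A\<^sup>*\<close> maps the space of smooth vectors to itself and
  commutes with \<open>A\<close> there; hence \<open>E (n + 1) f h = E n (G f) h\<close>, and every \<open>E n\<close> is a symmetric
  bilinear form. It is positive because \<open>E 0\<close> is a covariance, \<open>E 1 f f = -2 (A f, f)\<close> with \<open>A\<close>
  dissipative, and \<open>E (n + 2) f f = E n (G f) (G f)\<close>. Log-convexity is then the Cauchy-Schwarz
  inequality for \<open>E n\<close> at the pair \<open>f\<close>, \<open>G f\<close>. The commutation replaces the spectral
  theorem; it follows from \<open>(A f, A h) = (A\<^sup>* f, A\<^sup>* h)\<close> and \<open>A\<^sup>*\<^sup>* = A\<close>.\<close>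

section \<open>Square-integrable functions\<close>

text \<open>The delicate point in the commutation is the domain: \<open>B f\<close> (with
  \<open>B\<close> the adjoint of \<open>A\<close>) must first be known to lie in \<open>D\<close>
  before \<open>A (B f)\<close> means anything. Testing against \<open>B h\<close> places it in the
  domain of the biadjoint, so \<open>A** = A\<close> is used for membership as much as for the
  value. Closedness of \<open>A\<close>, on which \<open>A** = A\<close> rests, is itself drawn from
  normality. \<open>E 0\<close> is a covariance, not the scalar product. Moving \<open>A\<close>
  across it requires the products of means to vanish on both sides: \<open>(A f, 1) = 0\<close>
  comes from stationarity, and \<open>(B f, 1) = 0\<close> from \<open>A 1 = 0\<close>. The adjoint
  is single-valued only because \<open>D\<close> is dense. This takes the density of C(Z) in L2 and
  then time averages of orbits, which are formed in C(Z) and lie in \<open>D\<close>. Operators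
  return representatives picked by \<open>SOME\<close>, so linearity and commutation hold only up to
  \<open>L2_eq\<close>; domains and energies are therefore shown to respect \<open>L2_eq\<close>
  before any algebra is done with them.\<close>

lemma L2D:
  assumes "f \<in> L2 M"
  shows "f \<in> borel_measurable M" "integrable M (\<lambda>x. (f x)\<^sup>2)"
  using assms by (auto simp: L2_def)

lemma integrable_mult_L2:
  assumes f: "f \<in> L2 M" and g: "g \<in> L2 M"
  shows "integrable M (\<lambda>x. f x * g x)"
proof (rule Bochner_Integration.integrable_bound[where f = "\<lambda>x. (f x)\<^sup>2 + (g x)\<^sup>2"])
  show "integrable M (\<lambda>x. (f x)\<^sup>2 + (g x)\<^sup>2)"
    using L2D[OF f] L2D[OF g] by simp
  show "(\<lambda>x. f x * g x) \<in> borel_measurable M"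
    using L2D(1)[OF f] L2D(1)[OF g] by simp
  have "\<bar>a * b\<bar> \<le> a\<^sup>2 + b\<^sup>2" for a b :: real
  proof -
    have "2 * \<bar>a * b\<bar> \<le> a\<^sup>2 + b\<^sup>2"
      using sum_squares_bound[of "\<bar>a\<bar>" "\<bar>b\<bar>"] by (simp add: abs_mult mult.assoc)
    then show ?thesis by linarith
  qed
  then show "AE x in M. norm (f x * g x) \<le> norm ((f x)\<^sup>2 + (g x)\<^sup>2)"
    by simp
qed

lemma L2_zero [simp]: "(\<lambda>x. 0) \<in> L2 M"
  by (simp add: L2_def)

lemma L2_add [simp]:
  assumes "f \<in> L2 M" "g \<in> L2 M"
  shows "(\<lambda>x. f x + g x) \<in> L2 M"
  using L2D[OF assms(1)] L2D[OF assms(2)] integrable_mult_L2[OF assms]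
  by (simp add: L2_def power2_sum mult.assoc)

lemma L2_scale [simp]: "f \<in> L2 M \<Longrightarrow> (\<lambda>x. c * f x) \<in> L2 M"
  by (auto simp: L2_def power_mult_distrib)

lemma L2_uminus [simp]: "f \<in> L2 M \<Longrightarrow> (\<lambda>x. - f x) \<in> L2 M"
  by (auto simp: L2_def)

lemma L2_diff [simp]: "f \<in> L2 M \<Longrightarrow> g \<in> L2 M \<Longrightarrow> (\<lambda>x. f x - g x) \<in> L2 M"
  using L2_add[of f M "\<lambda>x. - g x"] by simp

lemma L2_divide [simp]: "f \<in> L2 M \<Longrightarrow> (\<lambda>x. f x / c) \<in> L2 M"
  using L2_scale[of f M "1 / c"] by simp

lemma L2_inner_commute: "L2_inner M f g = L2_inner M g f"
  by (simp add: L2_inner_def mult.commute)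

lemma L2_inner_add_left [simp]:
  "f \<in> L2 M \<Longrightarrow> g \<in> L2 M \<Longrightarrow> h \<in> L2 M \<Longrightarrow>
     L2_inner M (\<lambda>x. f x + g x) h = L2_inner M f h + L2_inner M g h"
  by (simp add: L2_inner_def distrib_right integrable_mult_L2)

lemma L2_inner_diff_left [simp]:
  "f \<in> L2 M \<Longrightarrow> g \<in> L2 M \<Longrightarrow> h \<in> L2 M \<Longrightarrow>
     L2_inner M (\<lambda>x. f x - g x) h = L2_inner M f h - L2_inner M g h"
  by (simp add: L2_inner_def left_diff_distrib integrable_mult_L2)

lemma L2_inner_scale_left [simp]: "L2_inner M (\<lambda>x. c * f x) h = c * L2_inner M f h"
  by (simp add: L2_inner_def mult.assoc)

lemma L2_inner_uminus_left [simp]: "L2_inner M (\<lambda>x. - f x) h = - L2_inner M f h"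
  by (simp add: L2_inner_def)

lemma L2_inner_divide_left [simp]: "L2_inner M (\<lambda>x. f x / c) h = L2_inner M f h / c"
  using L2_inner_scale_left[of M "1 / c" f h] by simp

lemma L2_inner_add_right [simp]:
  "f \<in> L2 M \<Longrightarrow> g \<in> L2 M \<Longrightarrow> h \<in> L2 M \<Longrightarrow>
     L2_inner M h (\<lambda>x. f x + g x) = L2_inner M h f + L2_inner M h g"
  by (simp add: L2_inner_commute[of M h])

lemma L2_inner_diff_right [simp]:
  "f \<in> L2 M \<Longrightarrow> g \<in> L2 M \<Longrightarrow> h \<in> L2 M \<Longrightarrow>
     L2_inner M h (\<lambda>x. f x - g x) = L2_inner M h f - L2_inner M h g"
  by (simp add: L2_inner_commute[of M h])

lemma L2_inner_scale_right [simp]: "L2_inner M h (\<lambda>x. c * f x) = c * L2_inner M h f"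
  by (simp add: L2_inner_commute[of M h])

lemma L2_inner_uminus_right [simp]: "L2_inner M h (\<lambda>x. - f x) = - L2_inner M h f"
  by (simp add: L2_inner_commute[of M h])

lemma L2_inner_nonneg [simp]: "0 \<le> L2_inner M f f"
  by (simp add: L2_inner_def)

lemma L2_norm_nonneg [simp]: "0 \<le> L2_norm M f"
  by (simp add: L2_norm_def)

lemma L2_norm_power2: "(L2_norm M f)\<^sup>2 = L2_inner M f f"
  by (simp add: L2_norm_def)

lemma L2_norm_zero [simp]: "L2_norm M (\<lambda>x. 0) = 0"
  by (simp add: L2_norm_def L2_inner_def)

text \<open>This is the discriminant criterion, kept for abstract coefficients so that it serves the
  scalar product, the energies and, with \<open>a = 0\<close>, the first variation in
  \<open>biadjoint\<close>.\<close>

lemma quadratic_nonneg_imp_le: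
  fixes a b c :: real
  assumes "\<And>s. 0 \<le> a + 2 * s * b + s\<^sup>2 * c" and "0 \<le> c"
  shows "b\<^sup>2 \<le> a * c"
proof (cases "c = 0")
  case True
  have "b = 0"
  proof (rule ccontr)
    assume "b \<noteq> 0"
    \<comment> \<open>For \<open>c = 0\<close> the expression is affine in \<open>s\<close>; this
      \<open>s\<close> is the point where it takes the value -1.\<close>
    then have "a + 2 * (- (a + 1) / (2 * b)) * b + (- (a + 1) / (2 * b))\<^sup>2 * c = -1"
      using True by (simp add: field_simps)
    with assms(1)[of "- (a + 1) / (2 * b)"] show False by simp
  qed
  with True show ?thesis by simp
next
  case False
  with assms(2) have c: "0 < c" by simp
  \<comment> \<open>The point \<open>s = - b / c\<close> is the vertex of the parabola.\<close>
  have "a + 2 * (- b / c) * b + (- b / c)\<^sup>2 * c = a - b\<^sup>2 / c"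
    using c by (simp add: field_simps power2_eq_square)
  with assms(1)[of "- b / c"] have "b\<^sup>2 / c \<le> a" by simp
  with c show ?thesis by (simp add: field_simps)
qed

lemma L2_Cauchy_Schwarz:
  assumes f: "f \<in> L2 M" and g: "g \<in> L2 M"
  shows "\<bar>L2_inner M f g\<bar> \<le> L2_norm M f * L2_norm M g"
proof -
  have "0 \<le> L2_inner M f f + 2 * s * L2_inner M f g + s\<^sup>2 * L2_inner M g g" for s
    using L2_inner_nonneg[of M "\<lambda>x. f x + s * g x"] f g
    by (simp add: L2_inner_commute[of M g f] algebra_simps power2_eq_square)
  then have "(L2_inner M f g)\<^sup>2 \<le> L2_inner M f f * L2_inner M g g"
    by (rule quadratic_nonneg_imp_le) simp
  then have "(L2_inner M f g)\<^sup>2 \<le> (L2_norm M f * L2_norm M g)\<^sup>2"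
    by (simp add: power_mult_distrib L2_norm_power2)
  then show ?thesis
    by (metis abs_le_square_iff abs_of_nonneg L2_norm_nonneg mult_nonneg_nonneg)
qed

lemma L2_norm_triangle:
  assumes f: "f \<in> L2 M" and g: "g \<in> L2 M"
  shows "L2_norm M (\<lambda>x. f x + g x) \<le> L2_norm M f + L2_norm M g"
proof (rule power2_le_imp_le)
  show "(L2_norm M (\<lambda>x. f x + g x))\<^sup>2 \<le> (L2_norm M f + L2_norm M g)\<^sup>2"
    using f g L2_Cauchy_Schwarz[OF f g]
    by (simp add: L2_norm_power2 power2_sum L2_inner_commute[of M g f])
qed simp

lemma L2_norm_scale [simp]: "L2_norm M (\<lambda>x. c * f x) = \<bar>c\<bar> * L2_norm M f"
  by (simp add: L2_norm_def real_sqrt_mult flip: mult.assoc)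

text \<open>This is the parallelogram law for \<open>c - a\<close> and \<open>c - b\<close>, whose
  half sum is \<open>c - (a + b) / 2\<close>. In \<open>biadjoint\<close> it makes a minimizing
  sequence Cauchy.\<close>

lemma L2_parallelogram:
  assumes "a \<in> L2 M" "b \<in> L2 M" "c \<in> L2 M"
  shows "(L2_norm M (\<lambda>x. a x - b x))\<^sup>2 = 2 * (L2_norm M (\<lambda>x. c x - a x))\<^sup>2
    + 2 * (L2_norm M (\<lambda>x. c x - b x))\<^sup>2 - 4 * (L2_norm M (\<lambda>x. c x - (1/2) * (a x + b x)))\<^sup>2"
proof -
  note comm = L2_inner_commute[of M b a] L2_inner_commute[of M a c] L2_inner_commute[of M b c]
  have half: "(L2_norm M (\<lambda>x. c x - (1/2) * (a x + b x)))\<^sup>2 = L2_inner M c c - L2_inner M c a - L2_inner M c b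
      + (L2_inner M a a + 2 * L2_inner M a b + L2_inner M b b) / 4"
    using assms unfolding L2_norm_power2
    by (simp only: L2_inner_diff_left L2_inner_diff_right L2_inner_scale_left L2_inner_scale_right
        L2_inner_add_left L2_inner_add_right L2_add L2_scale L2_diff comm)
      (simp add: field_simps)
  have sq: "(L2_norm M (\<lambda>x. f x - g x))\<^sup>2 = L2_inner M f f - 2 * L2_inner M f g + L2_inner M g g"
    if "f \<in> L2 M" "g \<in> L2 M" for f g
    using that by (simp add: L2_norm_power2 L2_inner_commute[of M g f])
  show ?thesis
    unfolding half sq[OF assms(1,2)] sq[OF assms(3,1)] sq[OF assms(3,2)] by (simp add: field_simps)
qed

lemma L2_norm_uminus [simp]: "L2_norm M (\<lambda>x. - f x) = L2_norm M f"
  by (simp add: L2_norm_def)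

lemma L2_norm_diff_commute: "L2_norm M (\<lambda>x. f x - g x) = L2_norm M (\<lambda>x. g x - f x)"
  using L2_norm_uminus[of M "\<lambda>x. f x - g x"] by simp

lemma L2_norm_diff_triangle:
  assumes "f \<in> L2 M" "g \<in> L2 M" "h \<in> L2 M"
  shows "L2_norm M (\<lambda>x. f x - h x) \<le> L2_norm M (\<lambda>x. f x - g x) + L2_norm M (\<lambda>x. g x - h x)"
  using L2_norm_triangle[of "\<lambda>x. f x - g x" M "\<lambda>x. g x - h x"] assms by simp

text \<open>Almost everywhere equality is expressed through the norm, so that later arguments stay
  within scalar products and norms. Membership of both sides is built in because the linearity rules
  ask for it each time.\<close>

definition L2_eq :: "'z measure \<Rightarrow> ('z \<Rightarrow> real) \<Rightarrow> ('z \<Rightarrow> real) \<Rightarrow> bool" where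
  "L2_eq M f g \<longleftrightarrow> f \<in> L2 M \<and> g \<in> L2 M \<and> L2_norm M (\<lambda>x. f x - g x) = 0"

lemma L2_eq_mem: "L2_eq M f g \<Longrightarrow> f \<in> L2 M" "L2_eq M f g \<Longrightarrow> g \<in> L2 M"
  by (auto simp: L2_eq_def)

lemma L2_eq_refl [simp]: "f \<in> L2 M \<Longrightarrow> L2_eq M f f"
  by (simp add: L2_eq_def)

lemma L2_eq_sym: "L2_eq M f g \<Longrightarrow> L2_eq M g f"
  using L2_norm_diff_commute[of M f g] by (simp add: L2_eq_def)

lemma L2_eq_trans [trans]: "L2_eq M f g \<Longrightarrow> L2_eq M g h \<Longrightarrow> L2_eq M f h"
  unfolding L2_eq_def using L2_norm_diff_triangle[of f M g h]
  by (metis L2_norm_nonneg add_0_right antisym)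

lemma L2_eqI:
  assumes "f \<in> L2 M" "g \<in> L2 M" "L2_inner M (\<lambda>x. f x - g x) (\<lambda>x. f x - g x) = 0"
  shows "L2_eq M f g"
  using assms by (simp add: L2_eq_def L2_norm_def)

lemma L2_eq_inner_left:
  assumes "L2_eq M f g" "h \<in> L2 M"
  shows "L2_inner M f h = L2_inner M g h"
proof -
  have "\<bar>L2_inner M (\<lambda>x. f x - g x) h\<bar> \<le> 0"
    using L2_Cauchy_Schwarz[of "\<lambda>x. f x - g x" M h] assms by (simp add: L2_eq_def)
  then show ?thesis using assms by (simp add: L2_eq_def)
qed

lemma L2_eq_inner_right:
  "L2_eq M f g \<Longrightarrow> h \<in> L2 M \<Longrightarrow> L2_inner M h f = L2_inner M h g"
  using L2_eq_inner_left by (metis L2_inner_commute)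

lemma L2_eq_norm: "L2_eq M f g \<Longrightarrow> L2_norm M f = L2_norm M g"
  by (simp add: L2_norm_def L2_eq_inner_left L2_eq_inner_right L2_eq_mem)

lemma L2_eq_add:
  assumes "L2_eq M f f'" "L2_eq M g g'"
  shows "L2_eq M (\<lambda>x. f x + g x) (\<lambda>x. f' x + g' x)"
proof -
  have "L2_norm M (\<lambda>x. (f x - f' x) + (g x - g' x)) \<le> 0"
    using assms L2_norm_triangle[of "\<lambda>x. f x - f' x" M "\<lambda>x. g x - g' x"]
    by (simp add: L2_eq_def)
  then have "L2_norm M (\<lambda>x. (f x + g x) - (f' x + g' x)) = 0"
    using L2_norm_nonneg[of M "\<lambda>x. (f x - f' x) + (g x - g' x)"] by (simp add: add_diff_add)
  then show ?thesis using assms by (simp add: L2_eq_def)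
qed

lemma L2_eq_scale: "L2_eq M f g \<Longrightarrow> L2_eq M (\<lambda>x. c * f x) (\<lambda>x. c * g x)"
  by (simp add: L2_eq_def flip: right_diff_distrib)

lemma L2_eq_uminus: "L2_eq M f g \<Longrightarrow> L2_eq M (\<lambda>x. - f x) (\<lambda>x. - g x)"
  using L2_eq_scale[of M f g "-1"] by simp

lemma L2_eq_diff:
  "L2_eq M f f' \<Longrightarrow> L2_eq M g g' \<Longrightarrow> L2_eq M (\<lambda>x. f x - g x) (\<lambda>x. f' x - g' x)"
  using L2_eq_add[of M f f' "\<lambda>x. - g x" "\<lambda>x. - g' x"] L2_eq_uminus[of M g g'] by simp

section \<open>Convergence in the L2 norm\<close>

lemma L2_tendstoD: "L2_tendsto M u f F \<Longrightarrow> ((\<lambda>b. L2_norm M (\<lambda>x. u b x - f x)) \<longlongrightarrow> 0) F"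
  by (simp add: L2_tendsto_def)

lemma L2_tendsto_const [simp]: "L2_tendsto M (\<lambda>b. f) f F"
  by (simp add: L2_tendsto_def)

lemma L2_tendsto_bound:
  assumes "\<forall>\<^sub>F b in F. L2_norm M (\<lambda>x. u b x - f x) \<le> e b" "(e \<longlongrightarrow> 0) F"
  shows "L2_tendsto M u f F"
  unfolding L2_tendsto_def
  by (rule tendsto_sandwich[OF _ assms(1) tendsto_const assms(2)]) simp

lemma L2_tendsto_add:
  assumes "L2_tendsto M u f F" "L2_tendsto M v g F"
    and "\<forall>\<^sub>F b in F. u b \<in> L2 M \<and> v b \<in> L2 M" "f \<in> L2 M" "g \<in> L2 M"
  shows "L2_tendsto M (\<lambda>b x. u b x + v b x) (\<lambda>x. f x + g x) F"
proof (rule L2_tendsto_bound)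
  show "((\<lambda>b. L2_norm M (\<lambda>x. u b x - f x) + L2_norm M (\<lambda>x. v b x - g x)) \<longlongrightarrow> 0) F"
    using tendsto_add[OF L2_tendstoD[OF assms(1)] L2_tendstoD[OF assms(2)]] by simp
  show "\<forall>\<^sub>F b in F. L2_norm M (\<lambda>x. (u b x + v b x) - (f x + g x))
      \<le> L2_norm M (\<lambda>x. u b x - f x) + L2_norm M (\<lambda>x. v b x - g x)"
    using assms(3)
  proof eventually_elim
    case (elim b)
    then show ?case
      using L2_norm_triangle[of "\<lambda>x. u b x - f x" M "\<lambda>x. v b x - g x"] assms(4,5)
      by (simp add: add_diff_add)
  qed
qed

lemma L2_tendsto_scale:
  assumes "L2_tendsto M u f F"
  shows "L2_tendsto M (\<lambda>b x. c * u b x) (\<lambda>x. c * f x) F"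
  using tendsto_mult_left[OF L2_tendstoD[OF assms], of "\<bar>c\<bar>"]
  by (simp add: L2_tendsto_def flip: right_diff_distrib)

lemma L2_tendsto_diff:
  assumes "L2_tendsto M u f F" "L2_tendsto M v g F"
    and "\<forall>\<^sub>F b in F. u b \<in> L2 M \<and> v b \<in> L2 M" "f \<in> L2 M" "g \<in> L2 M"
  shows "L2_tendsto M (\<lambda>b x. u b x - v b x) (\<lambda>x. f x - g x) F"
proof -
  have "\<forall>\<^sub>F b in F. u b \<in> L2 M \<and> (\<lambda>x. - 1 * v b x) \<in> L2 M"
    using assms(3) by eventually_elim simp
  from L2_tendsto_add[OF assms(1) L2_tendsto_scale[OF assms(2)] this] assms(4,5)
  show ?thesis by simp
qed

lemma L2_tendsto_inner:
  assumes "L2_tendsto M u f F" "\<forall>\<^sub>F b in F. u b \<in> L2 M" "f \<in> L2 M" "h \<in> L2 M"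
  shows "((\<lambda>b. L2_inner M (u b) h) \<longlongrightarrow> L2_inner M f h) F"
proof -
  have "((\<lambda>b. L2_inner M (u b) h - L2_inner M f h) \<longlongrightarrow> 0) F"
  proof (rule Lim_null_comparison)
    show "((\<lambda>b. L2_norm M (\<lambda>x. u b x - f x) * L2_norm M h) \<longlongrightarrow> 0) F"
      using tendsto_mult_right[OF L2_tendstoD[OF assms(1)], of "L2_norm M h"] by simp
    show "\<forall>\<^sub>F b in F. norm (L2_inner M (u b) h - L2_inner M f h)
        \<le> L2_norm M (\<lambda>x. u b x - f x) * L2_norm M h"
      using assms(2)
    proof eventually_elim
      case (elim b)
      then show ?case
        using L2_Cauchy_Schwarz[of "\<lambda>x. u b x - f x" M h] assms(3,4) by simp
    qed
  qed
  then show ?thesis by (rule LIM_zero_cancel)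
qed

lemma L2_tendsto_norm:
  assumes "L2_tendsto M u f F" "\<forall>\<^sub>F b in F. u b \<in> L2 M" "f \<in> L2 M"
  shows "((\<lambda>b. L2_norm M (u b)) \<longlongrightarrow> L2_norm M f) F"
proof -
  have "((\<lambda>b. L2_norm M (u b) - L2_norm M f) \<longlongrightarrow> 0) F"
  proof (rule Lim_null_comparison[OF _ L2_tendstoD[OF assms(1)]])
    show "\<forall>\<^sub>F b in F. norm (L2_norm M (u b) - L2_norm M f) \<le> L2_norm M (\<lambda>x. u b x - f x)"
      using assms(2)
    proof eventually_elim
      case (elim b)
      then show ?case
        using L2_norm_triangle[of "\<lambda>x. u b x - f x" M f]
          L2_norm_triangle[of "\<lambda>x. f x - u b x" M "u b"] assms(3)
        by (simp add: L2_norm_diff_commute[of M f])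
    qed
  qed
  then show ?thesis by (rule LIM_zero_cancel)
qed

lemma L2_tendsto_unique:
  assumes "L2_tendsto M u f F" "L2_tendsto M u g F" "F \<noteq> bot"
    and "\<forall>\<^sub>F b in F. u b \<in> L2 M" "f \<in> L2 M" "g \<in> L2 M"
  shows "L2_eq M f g"
proof -
  \<comment> \<open>The zero function \<open>u b - u b\<close> is a difference of sequences with
    limits \<open>f\<close> and \<open>g\<close>, so the constant 0 tends to the norm of
    \<open>f - g\<close>.\<close>
  have "((\<lambda>b. L2_norm M (\<lambda>x. u b x - u b x)) \<longlongrightarrow> L2_norm M (\<lambda>x. f x - g x)) F"
    using assms
    by (intro L2_tendsto_norm L2_tendsto_diff) (auto elim: eventually_mono)
  then have "L2_norm M (\<lambda>x. f x - g x) = 0"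
    using assms(3) by (simp add: tendsto_const_iff)
  with assms(5,6) show ?thesis by (simp add: L2_eq_def)
qed

lemma L2_eq_tendsto:
  assumes "L2_tendsto M u f F" "L2_eq M f g" "\<forall>\<^sub>F b in F. u b \<in> L2 M"
  shows "L2_tendsto M u g F"
proof (rule L2_tendsto_bound[OF _ L2_tendstoD[OF assms(1)]])
  show "\<forall>\<^sub>F b in F. L2_norm M (\<lambda>x. u b x - g x) \<le> L2_norm M (\<lambda>x. u b x - f x)"
    using assms(3)
  proof eventually_elim
    case (elim b)
    then show ?case
      using L2_norm_diff_triangle[of "u b" M f g] assms(2) by (simp add: L2_eq_def)
  qed
qed

lemma L2_eq_divide: "L2_eq M f g \<Longrightarrow> L2_eq M (\<lambda>x. f x / c) (\<lambda>x. g x / c)"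
  using L2_eq_scale[of M f g "1 / c"] by simp

lemma L2_tendsto_cong:
  assumes "L2_tendsto M u f F" "\<forall>\<^sub>F b in F. L2_eq M (u b) (v b)" "L2_eq M f g"
  shows "L2_tendsto M v g F"
proof (rule L2_tendsto_bound[OF _ L2_tendstoD[OF assms(1)]])
  show "\<forall>\<^sub>F b in F. L2_norm M (\<lambda>x. v b x - g x) \<le> L2_norm M (\<lambda>x. u b x - f x)"
    using assms(2)
  proof eventually_elim
    case (elim b)
    show ?case
      using L2_eq_norm[OF L2_eq_diff[OF elim assms(3)]] by simp
  qed
qed

section \<open>Completeness of L2 over a probability space\<close>

lemma L2_norm_const:
  assumes "prob_space M" shows "L2_norm M (\<lambda>x. c) = \<bar>c\<bar>"
  using prob_space.prob_space[OF assms] by (simp add: L2_norm_def L2_inner_def)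

lemma L2_const:
  assumes "prob_space M" shows "(\<lambda>x. c) \<in> L2 M"
  using prob_space.finite_measure[OF assms] by (simp add: L2_def finite_measure.integrable_const)

lemma L2_abs: "f \<in> L2 M \<Longrightarrow> (\<lambda>x. \<bar>f x\<bar>) \<in> L2 M"
  by (auto simp: L2_def)

lemma nn_integral_power2_L2:
  "f \<in> L2 M \<Longrightarrow> (\<integral>\<^sup>+x. ennreal ((f x)\<^sup>2) \<partial>M) = ennreal ((L2_norm M f)\<^sup>2)"
  using L2D[of f M]
  by (simp add: nn_integral_eq_integral L2_norm_power2 L2_inner_def flip: power2_eq_square)

text \<open>Cauchy-Schwarz against the constant 1, which has norm 1. In \<open>L2_complete\<close>
  it turns summable norms of increments into almost everywhere absolute summability.\<close>

lemma nn_integral_abs_le_L2_norm: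
  assumes "prob_space M" and f: "f \<in> L2 M"
  shows "(\<integral>\<^sup>+x. ennreal \<bar>f x\<bar> \<partial>M) \<le> ennreal (L2_norm M f)"
proof -
  have one: "(\<lambda>x. 1) \<in> L2 M" using L2_const[OF assms(1)] .
  have int: "integrable M (\<lambda>x. \<bar>f x\<bar>)"
    using integrable_mult_L2[OF L2_abs[OF f] one] by simp
  have "(\<integral>x. \<bar>f x\<bar> \<partial>M) \<le> L2_norm M (\<lambda>x. \<bar>f x\<bar>) * L2_norm M (\<lambda>x. 1)"
    using L2_Cauchy_Schwarz[OF L2_abs[OF f] one] by (simp add: L2_inner_def)
  also have "\<dots> = L2_norm M f"
    using L2_norm_const[OF assms(1), of 1] by (simp add: L2_norm_def L2_inner_def)
  finally show ?thesis
    using int by (simp add: nn_integral_eq_integral ennreal_leI)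
qed

text \<open>Riesz-Fischer: a fast Cauchy subsequence converges almost everywhere, and Fatou's lemma
  turns the pointwise limit into a limit in norm.\<close>

lemma L2_complete:
  assumes M: "prob_space M" and u: "\<And>n::nat. u n \<in> L2 M"
    and Cauchy: "\<And>e. e > 0 \<Longrightarrow> \<exists>N. \<forall>m\<ge>N. \<forall>n\<ge>N. L2_norm M (\<lambda>x. u m x - u n x) < e"
  obtains f where "f \<in> L2 M" "L2_tendsto M u f sequentially"
proof -
  have [measurable]: "u n \<in> borel_measurable M" for n
    using L2D(1)[OF u] .
  have "\<forall>k. \<exists>N. \<forall>m\<ge>N. \<forall>n\<ge>N. L2_norm M (\<lambda>x. u m x - u n x) < (1/2) ^ k"
    using Cauchy by simp
  then obtain q where q: "\<And>k m n. q k \<le> m \<Longrightarrow> q k \<le> n \<Longrightarrow>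
      L2_norm M (\<lambda>x. u m x - u n x) < (1/2) ^ k"
    by metis
  \<comment> \<open>Partial sums make the indices monotone while keeping
    \<open>q k \<le> r k\<close>, so the increments along \<open>r\<close> have norm below
    \<open>(1/2) ^ k\<close>.\<close>
  define r where "r k = (\<Sum>i\<le>k. q i)" for k :: nat
  have r_mono: "r j \<le> r k" if "j \<le> k" for j k
    unfolding r_def using that by (intro sum_mono2) auto
  have q_le: "q k \<le> r k" for k
    unfolding r_def by (rule member_le_sum) auto
  have r: "L2_norm M (\<lambda>x. u (r j) x - u m x) < (1/2) ^ k" if "k \<le> j" "r k \<le> m" for j k m
    using q[of k "r j" m] r_mono[OF that(1)] q_le[of k] that(2) by linarith
  define d where "d k x = u (r (Suc k)) x - u (r k) x" for k x
  have d: "d k \<in> L2 M" for k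
    unfolding d_def using u by simp
  have [measurable]: "d k \<in> borel_measurable M" for k
    using L2D(1)[OF d] .
  have "(\<integral>\<^sup>+x. (\<Sum>k. ennreal \<bar>d k x\<bar>) \<partial>M) = (\<Sum>k. \<integral>\<^sup>+x. ennreal \<bar>d k x\<bar> \<partial>M)"
    by (rule nn_integral_suminf) simp
  also have "\<dots> \<le> (\<Sum>k. ennreal ((1/2) ^ k))"
  proof (intro suminf_le)
    fix k
    have "L2_norm M (d k) \<le> (1/2) ^ k"
      unfolding d_def using r[of k "Suc k" "r k"] by simp
    with nn_integral_abs_le_L2_norm[OF M d, of k]
    show "(\<integral>\<^sup>+x. ennreal \<bar>d k x\<bar> \<partial>M) \<le> ennreal ((1/2) ^ k)"
      by (meson ennreal_leI order_trans)
  qed auto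
  also have "\<dots> = ennreal (\<Sum>k. (1/2) ^ k)"
    by (rule suminf_ennreal_eq) (auto intro: summable_sums)
  finally have "(\<integral>\<^sup>+x. (\<Sum>k. ennreal \<bar>d k x\<bar>) \<partial>M) \<noteq> \<infinity>"
    by (auto simp: top_unique)
  then have "AE x in M. (\<Sum>k. ennreal \<bar>d k x\<bar>) \<noteq> \<infinity>"
    by (intro nn_integral_PInf_AE) auto
  then have conv: "AE x in M. convergent (\<lambda>k. u (r k) x)"
  proof eventually_elim
    case (elim x)
    then have "summable (\<lambda>k. \<bar>d k x\<bar>)"
      by (intro summable_suminf_not_top) auto
    then have "summable (\<lambda>k. d k x)"
      by (rule summable_rabs_cancel)
    then have "convergent (\<lambda>n. \<Sum>k<n. d k x)"
      by (simp add: summable_iff_convergent)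
    moreover have "(\<Sum>k<n. d k x) = u (r n) x - u (r 0) x" for n
      unfolding d_def by (rule sum_lessThan_telescope)
    ultimately show ?case
      using convergent_diff_const_right_iff[of "\<lambda>n. u (r n) x" "u (r 0) x"] by simp
  qed
  \<comment> \<open>Where the subsequence diverges \<open>lim\<close> is an unspecified value; by
    \<open>conv\<close> this affects only a null set.\<close>
  define f where "f x = lim (\<lambda>k. u (r k) x)" for x
  have [measurable]: "f \<in> borel_measurable M"
    unfolding f_def by measurable
  have lim: "AE x in M. (\<lambda>k. u (r k) x) \<longlonglongrightarrow> f x"
    using conv by eventually_elim (simp add: f_def convergent_LIMSEQ_iff)
  \<comment> \<open>The bound is proved for every \<open>m\<close> beyond \<open>r k\<close>, not
    only along the subsequence, so the whole sequence converges. Finiteness of the integral also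
    gives that \<open>f - u m\<close>, and hence \<open>f\<close>, is square-integrable.\<close>
  have bound: "(\<lambda>x. f x - u m x) \<in> L2 M \<and> L2_norm M (\<lambda>x. f x - u m x) \<le> (1/2) ^ k"
    if m: "r k \<le> m" for k m
  proof -
    have "(\<integral>\<^sup>+x. ennreal ((f x - u m x)\<^sup>2) \<partial>M)
        = (\<integral>\<^sup>+x. liminf (\<lambda>j. ennreal ((u (r j) x - u m x)\<^sup>2)) \<partial>M)"
      using lim
    proof (intro nn_integral_cong_AE, eventually_elim)
      case (elim x)
      then have "(\<lambda>j. ennreal ((u (r j) x - u m x)\<^sup>2)) \<longlonglongrightarrow> ennreal ((f x - u m x)\<^sup>2)"
        by (intro tendsto_intros)
      then show ?case by (intro lim_imp_Liminf[symmetric]) simp_all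
    qed
    also have "\<dots> \<le> liminf (\<lambda>j. \<integral>\<^sup>+x. ennreal ((u (r j) x - u m x)\<^sup>2) \<partial>M)"
      by (rule nn_integral_liminf) measurable
    \<comment> \<open>The norm estimate holds only for \<open>j\<close> from \<open>k\<close> on; an
      eventual upper bound controls the limsup, and with it the liminf.\<close>
    also have "\<dots> \<le> limsup (\<lambda>j. \<integral>\<^sup>+x. ennreal ((u (r j) x - u m x)\<^sup>2) \<partial>M)"
      by (rule Liminf_le_Limsup) simp
    also have "\<dots> \<le> ennreal (((1/2) ^ k)\<^sup>2)"
    proof (rule Limsup_bounded)
      show "\<forall>\<^sub>F j in sequentially.
          (\<integral>\<^sup>+x. ennreal ((u (r j) x - u m x)\<^sup>2) \<partial>M) \<le> ennreal (((1/2) ^ k)\<^sup>2)"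
        using eventually_ge_at_top[of k]
      proof eventually_elim
        case (elim j)
        have "(L2_norm M (\<lambda>x. u (r j) x - u m x))\<^sup>2 \<le> ((1/2) ^ k)\<^sup>2"
          using r[OF elim m] by (intro power_mono) auto
        then show ?case
          using u by (simp add: nn_integral_power2_L2 ennreal_leI)
      qed
    qed
    finally have le: "(\<integral>\<^sup>+x. ennreal ((f x - u m x)\<^sup>2) \<partial>M) \<le> ennreal (((1/2) ^ k)\<^sup>2)" .
    then have "(\<integral>\<^sup>+x. ennreal ((f x - u m x)\<^sup>2) \<partial>M) < \<infinity>"
      using order_le_less_trans by fastforce
    then have mem: "(\<lambda>x. f x - u m x) \<in> L2 M"
      by (simp add: L2_def integrable_iff_bounded)
    with le have "(L2_norm M (\<lambda>x. f x - u m x))\<^sup>2 \<le> ((1/2) ^ k)\<^sup>2"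
      by (simp add: nn_integral_power2_L2)
    then have "L2_norm M (\<lambda>x. f x - u m x) \<le> (1/2) ^ k"
      by (rule power2_le_imp_le) simp
    with mem show ?thesis by simp
  qed
  show thesis
  proof
    show "f \<in> L2 M"
      using L2_add[of "\<lambda>x. f x - u (r 0) x" M "u (r 0)"] bound[of 0 "r 0"] u by simp
    show "L2_tendsto M u f sequentially"
      unfolding L2_tendsto_def
    proof (rule LIMSEQ_I)
      fix e :: real assume "e > 0"
      then obtain k where k: "(1/2) ^ k < e"
        using real_arch_pow_inv[of e "1/2"] by auto
      show "\<exists>N. \<forall>n\<ge>N. norm (L2_norm M (\<lambda>x. u n x - f x) - 0) < e"
      proof (intro exI[of _ "r k"] allI impI)
        fix n assume "r k \<le> n"
        from bound[OF this] k show "norm (L2_norm M (\<lambda>x. u n x - f x) - 0) < e"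
          by (simp add: L2_norm_diff_commute[of M "u n"])
      qed
    qed
  qed
qed

section \<open>Density of continuous functions\<close>

text \<open>The bound passes to the limit, so \<open>|f| <= w\<close> and the squares
  \<open>(s n - f)^2\<close> are dominated by the integrable function \<open>4 w^2\<close>.\<close>

lemma L2_tendsto_dominated:
  assumes [measurable]: "\<And>n::nat. s n \<in> borel_measurable M" "f \<in> borel_measurable M"
    and w: "w \<in> L2 M" "\<And>n x. x \<in> space M \<Longrightarrow> \<bar>s n x\<bar> \<le> w x"
    and lim: "\<And>x. x \<in> space M \<Longrightarrow> (\<lambda>n. s n x) \<longlonglongrightarrow> f x"
  shows "L2_tendsto M s f sequentially"
proof -
  have [measurable]: "w \<in> borel_measurable M"
    using L2D(1)[OF w(1)] .
  have f: "\<bar>f x\<bar> \<le> w x" if "x \<in> space M" for x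
    using tendsto_rabs[OF lim[OF that]] w(2)[OF that] by (intro LIMSEQ_le_const2) auto
  have "(\<lambda>n. \<integral>x. (s n x - f x)\<^sup>2 \<partial>M) \<longlonglongrightarrow> (\<integral>x. 0 \<partial>M)"
  proof (rule integral_dominated_convergence)
    show "integrable M (\<lambda>x. 4 * (w x)\<^sup>2)"
      using L2D(2)[OF w(1)] by simp
    show "AE x in M. (\<lambda>n. (s n x - f x)\<^sup>2) \<longlonglongrightarrow> 0"
    proof (rule AE_I2)
      fix x assume "x \<in> space M"
      from tendsto_power[OF tendsto_diff[OF lim[OF this] tendsto_const[of "f x"]], of 2]
      show "(\<lambda>n. (s n x - f x)\<^sup>2) \<longlonglongrightarrow> 0" by simp
    qed
    show "AE x in M. norm ((s n x - f x)\<^sup>2) \<le> 4 * (w x)\<^sup>2" for n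
    proof (rule AE_I2)
      fix x assume x: "x \<in> space M"
      have "\<bar>s n x - f x\<bar> \<le> 2 * w x"
        using w(2)[OF x, of n] f[OF x] by linarith
      then have "\<bar>s n x - f x\<bar>\<^sup>2 \<le> (2 * w x)\<^sup>2"
        by (intro power_mono) auto
      then show "norm ((s n x - f x)\<^sup>2) \<le> 4 * (w x)\<^sup>2"
        by (simp add: power_mult_distrib)
    qed
  qed measurable
  then have "(\<lambda>n. sqrt (\<integral>x. (s n x - f x)\<^sup>2 \<partial>M)) \<longlonglongrightarrow> 0"
    using tendsto_real_sqrt[of "\<lambda>n. \<integral>x. (s n x - f x)\<^sup>2 \<partial>M" 0 sequentially] by simp
  then show ?thesis
    by (simp add: L2_tendsto_def L2_norm_def L2_inner_def power2_eq_square)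
qed

lemma L2_dominated:
  assumes "f \<in> borel_measurable M" "w \<in> L2 M" "\<And>x. x \<in> space M \<Longrightarrow> \<bar>f x\<bar> \<le> w x"
  shows "f \<in> L2 M"
proof -
  have "integrable M (\<lambda>x. (f x)\<^sup>2)"
  proof (rule Bochner_Integration.integrable_bound[OF L2D(2)[OF assms(2)]])
    have "(f x)\<^sup>2 \<le> (w x)\<^sup>2" if "x \<in> space M" for x
      using power_mono[OF assms(3)[OF that], of 2] by simp
    then show "AE x in M. norm ((f x)\<^sup>2) \<le> norm ((w x)\<^sup>2)"
      by (intro AE_I2) simp
  qed (use assms(1) in simp)
  with assms(1) show ?thesis by (simp add: L2_def)
qed

lemma continuous_L2:
  fixes u :: "'z::topological_space \<Rightarrow>\<^sub>C real"
  assumes "prob_space M" "sets M = sets borel"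
  shows "apply_bcontfun u \<in> L2 M"
proof (rule L2_dominated[OF _ L2_const[OF assms(1)]])
  have "apply_bcontfun u \<in> borel_measurable borel"
    by (intro borel_measurable_continuous_onI) simp
  then show "apply_bcontfun u \<in> borel_measurable M"
    using measurable_cong_sets[OF assms(2) refl, of borel] by blast
  show "\<bar>apply_bcontfun u x\<bar> \<le> norm u" for x
    using norm_bounded[of u x] by simp
qed

text \<open>The total mass is 1, so integrating the constant bound costs nothing. Limits in the
  supremum norm thereby become limits in L2, which transfers the orbit calculus from C(Z).\<close>

lemma L2_norm_continuous_le:
  fixes u :: "'z::topological_space \<Rightarrow>\<^sub>C real"
  assumes M: "prob_space M" "sets M = sets borel"
  shows "L2_norm M (apply_bcontfun u) \<le> norm u"
proof -
  have "L2_inner M (apply_bcontfun u) (apply_bcontfun u) \<le> (\<integral>x. (norm u)\<^sup>2 \<partial>M)"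
    unfolding L2_inner_def
  proof (rule integral_mono)
    show "integrable M (\<lambda>x. apply_bcontfun u x * apply_bcontfun u x)"
      using continuous_L2[OF M] by (intro integrable_mult_L2)
    show "integrable M (\<lambda>x. (norm u)\<^sup>2)"
      using prob_space.finite_measure[OF M(1)] by (simp add: finite_measure.integrable_const)
    show "apply_bcontfun u x * apply_bcontfun u x \<le> (norm u)\<^sup>2" for x
      using power_mono[OF norm_bounded[of u x], of 2] by (simp add: power2_eq_square)
  qed
  also have "\<dots> = (norm u)\<^sup>2"
    using prob_space.prob_space[OF M(1)] by simp
  finally have "(L2_norm M (apply_bcontfun u))\<^sup>2 \<le> (norm u)\<^sup>2"
    by (simp only: L2_norm_power2)
  then show ?thesis
    by (rule power2_le_imp_le) (rule norm_ge_zero)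
qed

text \<open>This describes the L2-closure of C(Z). The aim is to show that it is everything, by
  building up from closed sets through Borel sets and simple functions.\<close>

definition cont_approx :: "'z::topological_space measure \<Rightarrow> ('z \<Rightarrow> real) \<Rightarrow> bool" where
  "cont_approx M f \<longleftrightarrow> f \<in> L2 M \<and>
     (\<forall>e>0. \<exists>u :: 'z \<Rightarrow>\<^sub>C real. L2_norm M (\<lambda>x. f x - apply_bcontfun u x) < e)"

lemma cont_approx_mem: "cont_approx M f \<Longrightarrow> f \<in> L2 M"
  unfolding cont_approx_def by (rule conjunct1)

lemma cont_approxD:
  "cont_approx M f \<Longrightarrow> e > 0 \<Longrightarrow>
     \<exists>u :: 'z::topological_space \<Rightarrow>\<^sub>C real. L2_norm M (\<lambda>x. f x - apply_bcontfun u x) < e"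
  unfolding cont_approx_def by blast

context
  fixes M :: "'z::topological_space measure"
  assumes M: "prob_space M" "sets M = sets borel"
begin

lemma cont_approx_continuous: "cont_approx M (apply_bcontfun u)"
  using continuous_L2[OF M] by (auto simp: cont_approx_def intro!: exI[of _ u])

lemma cont_approx_scale:
  assumes "cont_approx M f"
  shows "cont_approx M (\<lambda>x. c * f x)"
  unfolding cont_approx_def
proof (intro conjI allI impI)
  show "(\<lambda>x. c * f x) \<in> L2 M" using cont_approx_mem[OF assms] by simp
  fix e :: real assume "e > 0"
  \<comment> \<open>The added 1 keeps the denominator positive when \<open>c = 0\<close>.\<close>
  then have "0 < e / (\<bar>c\<bar> + 1)" by simp
  from cont_approxD[OF assms this] obtain u :: "'z \<Rightarrow>\<^sub>C real" where u: "L2_norm M (\<lambda>x. f x - apply_bcontfun u x) < e / (\<bar>c\<bar> + 1)"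
    by blast
  have "L2_norm M (\<lambda>x. c * f x - apply_bcontfun (c *\<^sub>R u) x)
      = L2_norm M (\<lambda>x. c * (f x - apply_bcontfun u x))"
    by (simp only: scaleR_bcontfun.rep_eq real_scaleR_def right_diff_distrib)
  then have "L2_norm M (\<lambda>x. c * f x - apply_bcontfun (c *\<^sub>R u) x)
      = \<bar>c\<bar> * L2_norm M (\<lambda>x. f x - apply_bcontfun u x)"
    unfolding L2_norm_scale .
  moreover have "\<bar>c\<bar> * L2_norm M (\<lambda>x. f x - apply_bcontfun u x)
      \<le> (\<bar>c\<bar> + 1) * L2_norm M (\<lambda>x. f x - apply_bcontfun u x)"
    by (rule mult_right_mono) simp_all
  moreover have "(\<bar>c\<bar> + 1) * L2_norm M (\<lambda>x. f x - apply_bcontfun u x) < e"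
    using u by (simp add: pos_less_divide_eq mult.commute)
  ultimately have "L2_norm M (\<lambda>x. c * f x - apply_bcontfun (c *\<^sub>R u) x) < e"
    by linarith
  then show "\<exists>u :: 'z \<Rightarrow>\<^sub>C real. L2_norm M (\<lambda>x. c * f x - apply_bcontfun u x) < e"
    by (rule exI[of _ "c *\<^sub>R u"])
qed

lemma cont_approx_add:
  assumes "cont_approx M f" "cont_approx M g"
  shows "cont_approx M (\<lambda>x. f x + g x)"
  unfolding cont_approx_def
proof (intro conjI allI impI)
  have mem: "f \<in> L2 M" "g \<in> L2 M" using assms by (auto intro: cont_approx_mem)
  then show "(\<lambda>x. f x + g x) \<in> L2 M" by simp
  fix e :: real assume "e > 0"
  then have "e / 2 > 0" by simp
  from cont_approxD[OF assms(1) this] cont_approxD[OF assms(2) this] obtain u v :: "'z \<Rightarrow>\<^sub>C real" where "L2_norm M (\<lambda>x. f x - apply_bcontfun u x) < e / 2"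
      "L2_norm M (\<lambda>x. g x - apply_bcontfun v x) < e / 2"
    by blast
  then have "L2_norm M (\<lambda>x. f x + g x - apply_bcontfun (u + v) x) < e"
    using L2_norm_triangle[of "\<lambda>x. f x - apply_bcontfun u x" M "\<lambda>x. g x - apply_bcontfun v x"]
      mem continuous_L2[OF M]
    by (simp add: add_diff_add)
  then show "\<exists>u :: 'z \<Rightarrow>\<^sub>C real. L2_norm M (\<lambda>x. f x + g x - apply_bcontfun u x) < e"
    by (rule exI[of _ "u + v"])
qed

lemma cont_approx_limit:
  assumes "L2_tendsto M s f sequentially" "\<And>n. cont_approx M (s n)" "f \<in> L2 M"
  shows "cont_approx M f"
  unfolding cont_approx_def
proof (intro conjI allI impI)
  show "f \<in> L2 M" by fact
  fix e :: real assume e: "e > 0"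
  then have "\<forall>\<^sub>F n in sequentially. L2_norm M (\<lambda>x. s n x - f x) < e / 2"
    using L2_tendstoD[OF assms(1)] by (intro order_tendstoD(2)) auto
  then obtain n where "L2_norm M (\<lambda>x. s n x - f x) < e / 2"
    using eventually_happens' sequentially_bot by blast
  then have n: "L2_norm M (\<lambda>x. f x - s n x) < e / 2"
    using L2_norm_diff_commute[of M f "s n"] by simp
  obtain u :: "'z \<Rightarrow>\<^sub>C real" where "L2_norm M (\<lambda>x. s n x - apply_bcontfun u x) < e / 2"
    using cont_approxD[OF assms(2), of "e / 2"] e by auto
  with n have "L2_norm M (\<lambda>x. f x - apply_bcontfun u x) < e"
    using L2_norm_diff_triangle[of f M "s n" "apply_bcontfun u"] cont_approx_mem[OF assms(2)]
      assms(3) continuous_L2[OF M]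
    by simp
  then show "\<exists>u :: 'z \<Rightarrow>\<^sub>C real. L2_norm M (\<lambda>x. f x - apply_bcontfun u x) < e"
    by (rule exI[of _ "u"])
qed

lemma cont_approx_sum:
  "finite I \<Longrightarrow> (\<And>i. i \<in> I \<Longrightarrow> cont_approx M (f i)) \<Longrightarrow> cont_approx M (\<lambda>x. \<Sum>i\<in>I. f i x)"
proof (induction rule: finite_induct)
  case empty
  have "cont_approx M (apply_bcontfun 0)" by (rule cont_approx_continuous)
  then show ?case by simp
next
  case (insert i I)
  then show ?case by (simp add: cont_approx_add)
qed

text \<open>A closed set in a metrizable space is the intersection of a decreasing sequence of open
  sets \<open>G n\<close>; Urysohn functions that are 1 on the set and 0 off \<open>G n\<close> decrease to its
  indicator.\<close>

lemma cont_approx_indicator_closed: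
  assumes metr: "metrizable_space (euclidean :: 'z topology)" and C: "closed C"
  shows "cont_approx M (indicat_real C)"
proof -
  have "closedin euclidean C" using C by simp
  then have "gdelta_in euclidean C"
    using closed_imp_gdelta_in metr by blast
  then obtain G where G: "\<And>n. open (G n)" "\<And>n. G (Suc n) \<subseteq> G n" "\<Inter> (range G) = C"
    unfolding gdelta_in_descending by auto
  have dec: "G j \<subseteq> G i" if "i \<le> j" for i j
    by (rule lift_Suc_antimono_le[of G, OF G(2) that])
  have "\<exists>u :: nat \<Rightarrow> 'z \<Rightarrow>\<^sub>C real. \<forall>n. (\<forall>x. apply_bcontfun (u n) x \<in> {0..1}) \<and>
      (\<forall>x\<in>C. apply_bcontfun (u n) x = 1) \<and> (\<forall>x\<in>-G n. apply_bcontfun (u n) x = 0)"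
  proof (rule choice, rule allI)
    fix n
    obtain f where f: "continuous_map euclidean (top_of_set {0..1::real}) f"
      "f ` (- G n) \<subseteq> {0}" "f ` C \<subseteq> {1}"
    proof (rule Urysohn_lemma[of euclidean "- G n" C 0 1])
      show "normal_space (euclidean :: 'z topology)"
        using metr by (rule metrizable_imp_normal_space)
      show "closedin euclidean (- G n)" "closedin euclidean C"
        using G(1) C by (auto simp: closed_Compl)
      show "disjnt (- G n) C" using G(3) by (auto simp: disjnt_def)
    qed auto
    have f01: "f x \<in> {0..1}" for x
      using f(1) by (auto simp: continuous_map_in_subtopology)
    have "continuous_on UNIV f"
      using f(1) by (simp add: continuous_map_in_subtopology)
    then have "f \<in> bcontfun"
      using f01 by (intro bcontfun_normI[of _ 1]) auto
    then have "apply_bcontfun (Bcontfun f) = f"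
      by (rule Bcontfun_inverse)
    with f f01 show "\<exists>u :: 'z \<Rightarrow>\<^sub>C real. (\<forall>x. apply_bcontfun u x \<in> {0..1}) \<and>
        (\<forall>x\<in>C. apply_bcontfun u x = 1) \<and> (\<forall>x\<in>-G n. apply_bcontfun u x = 0)"
      by (intro exI[of _ "Bcontfun f"]) auto
  qed
  then obtain u :: "nat \<Rightarrow> 'z \<Rightarrow>\<^sub>C real"
    where "\<forall>n. (\<forall>x. apply_bcontfun (u n) x \<in> {0..1}) \<and>
      (\<forall>x\<in>C. apply_bcontfun (u n) x = 1) \<and> (\<forall>x\<in>-G n. apply_bcontfun (u n) x = 0)"
    by blast
  then have u: "\<And>n x. apply_bcontfun (u n) x \<in> {0..1}"
      "\<And>n x. x \<in> C \<Longrightarrow> apply_bcontfun (u n) x = 1"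
      "\<And>n x. x \<notin> G n \<Longrightarrow> apply_bcontfun (u n) x = 0"
    by (blast, blast, blast)
  have [measurable]: "indicat_real C \<in> borel_measurable M"
    using C M(2) by (intro borel_measurable_indicator) auto
  have one: "(\<lambda>x. 1) \<in> L2 M" using L2_const[OF M(1)] .
  show ?thesis
  proof (rule cont_approx_limit)
    show "L2_tendsto M (\<lambda>n. apply_bcontfun (u n)) (indicat_real C) sequentially"
    proof (rule L2_tendsto_dominated[OF _ _ one])
      show "apply_bcontfun (u n) \<in> borel_measurable M" for n
        using L2D(1)[OF continuous_L2[OF M]] .
      show "\<bar>apply_bcontfun (u n) x\<bar> \<le> 1" for n x using u(1)[of n x] by simp
      show "(\<lambda>n. apply_bcontfun (u n) x) \<longlonglongrightarrow> indicat_real C x" for x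
      proof (cases "x \<in> C")
        case True then show ?thesis using u(2) by simp
      next
        case False
        then obtain n where "x \<notin> G n" using G(3) by auto
        then have "apply_bcontfun (u m) x = 0" if "m \<ge> n" for m
          using u(3) dec[OF that] by blast
        then have "\<forall>\<^sub>F m in sequentially. apply_bcontfun (u m) x = indicat_real C x"
          using False by (auto simp: eventually_sequentially)
        then show ?thesis by (rule tendsto_eventually)
      qed
    qed measurable
    show "indicat_real C \<in> L2 M"
      by (rule L2_dominated[OF _ one]) (auto simp: indicator_def)
  qed (rule cont_approx_continuous)
qed

text \<open>Dynkin's pi-lambda argument, started from the intersection-stable family of closed sets.
  Complements correspond to \<open>1 - indicator\<close>, and countable disjoint unions to dominated
  limits of finite sums.\<close>

lemma cont_approx_indicator:
  assumes metr: "metrizable_space (euclidean :: 'z topology)" and A: "A \<in> sets M"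
  shows "cont_approx M (indicat_real A)"
proof -
  \<comment> \<open>The Borel sets are introduced through open sets; complements exchange that
    generator for the closed sets on which the induction starts.\<close>
  have borel: "sets borel = sigma_sets UNIV {C :: 'z set. closed C}"
  proof -
    have "(borel :: 'z measure) = sigma UNIV (uminus ` {S. open S})"
      using borel_def
    proof (rule borel_eq_sigmaI1)
      fix S :: "'z set" assume "S \<in> {S. open S}"
      then have "- S \<in> sets (sigma UNIV (uminus ` {S. open S}))" by simp
      from sets.compl_sets[OF this] show "S \<in> sets (sigma UNIV (uminus ` {S. open S}))"
        by (simp add: Compl_eq_Diff_UNIV double_diff)
    qed auto
    moreover have "uminus ` {S. open S} = {C :: 'z set. closed C}"
    proof (intro equalityI subsetI)
      fix C :: "'z set" assume "C \<in> {C. closed C}"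
      then show "C \<in> uminus ` {S. open S}"
        by (intro image_eqI[of _ _ "- C"]) (simp_all add: open_Compl)
    qed (auto simp: closed_Compl)
    ultimately have "(borel :: 'z measure) = sigma UNIV {C. closed C}" by simp
    then have "sets (borel :: 'z measure) = sets (sigma UNIV {C. closed C})" by (rule arg_cong)
    also have "\<dots> = sigma_sets UNIV {C. closed C}" by (rule sets_measure_of) simp
    finally show ?thesis .
  qed
  have one: "(\<lambda>x. 1) \<in> L2 M" using L2_const[OF M(1)] .
  have "Int_stable {C :: 'z set. closed C}" by (auto simp: Int_stable_def)
  moreover have "{C :: 'z set. closed C} \<subseteq> Pow UNIV" by simp
  moreover have "A \<in> sigma_sets UNIV {C :: 'z set. closed C}" using A M(2) borel by simp
  ultimately show ?thesis
  proof (induction rule: sigma_sets_induct_disjoint)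
    case (basic A)
    then show ?case using cont_approx_indicator_closed[OF metr] by simp
  next
    case empty
    show ?case using cont_approx_indicator_closed[OF metr closed_empty] .
  next
    case (compl A)
    have "cont_approx M (\<lambda>x. apply_bcontfun (const_bcontfun 1) x + -1 * indicat_real A x)"
      by (intro cont_approx_add cont_approx_scale cont_approx_continuous compl)
    moreover have "(\<lambda>x. apply_bcontfun (const_bcontfun 1) x + -1 * indicat_real A x)
        = indicat_real (UNIV - A)"
      by (auto simp: indicator_def const_bcontfun.rep_eq)
    ultimately show ?case by simp
  next
    case (union A)
    have meas [measurable]: "A i \<in> sets M" for i
      using union(2) unfolding M(2) borel by blast
    show ?case
    proof (rule cont_approx_limit)
      show "L2_tendsto M (\<lambda>n x. \<Sum>i<n. indicat_real (A i) x) (indicat_real (\<Union>i. A i)) sequentially"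
      proof (rule L2_tendsto_dominated[OF _ _ one])
        fix n x
        have "(\<Sum>i<n. indicat_real (A i) x) = indicat_real (\<Union>i<n. A i) x"
          using union(1) by (intro indicator_UN_disjoint[symmetric])
            (auto simp: disjoint_family_on_def)
        then show "\<bar>\<Sum>i<n. indicat_real (A i) x\<bar> \<le> 1"
          by (simp add: indicator_def)
      next
        fix x
        have "(\<lambda>i. indicat_real (A i) x) sums indicat_real (\<Union>i. A i) x"
          using union(1) by (intro indicator_sums) (auto simp: disjoint_family_on_def)
        then show "(\<lambda>n. \<Sum>i<n. indicat_real (A i) x) \<longlonglongrightarrow> indicat_real (\<Union>i. A i) x"
          by (simp add: sums_def)
      qed measurable
      show "cont_approx M (\<lambda>x. \<Sum>i<n. indicat_real (A i) x)" for n
        using union(3) by (intro cont_approx_sum) auto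
      show "indicat_real (\<Union>i. A i) \<in> L2 M"
        by (rule L2_dominated[OF _ one]) (auto simp: indicator_def)
    qed
  qed
qed

text \<open>Measurability yields simple functions with \<open>|s i| <= 2 |f|\<close> converging
  pointwise to \<open>f\<close>. Domination upgrades this to L2 convergence, and each
  \<open>s i\<close> is a finite combination of indicators of its level sets.\<close>

lemma cont_approx_L2:
  assumes metr: "metrizable_space (euclidean :: 'z topology)" and f: "f \<in> L2 M"
  shows "cont_approx M f"
proof -
  obtain s where "\<forall>i. simple_function M (s i)" "\<forall>x\<in>space M. (\<lambda>i. s i x) \<longlonglongrightarrow> f x"
      "\<forall>i. \<forall>x\<in>space M. dist (s i x) 0 \<le> 2 * dist (f x) 0"
    using borel_measurable_implies_sequence_metric[OF L2D(1)[OF f], of 0] by blast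
  then have s: "\<And>i. simple_function M (s i)"
      "\<And>x. x \<in> space M \<Longrightarrow> (\<lambda>i. s i x) \<longlonglongrightarrow> f x"
      "\<And>i x. x \<in> space M \<Longrightarrow> \<bar>s i x\<bar> \<le> 2 * \<bar>f x\<bar>"
    by simp_all
  have sp: "space M = UNIV"
    using sets_eq_imp_space_eq[OF M(2)] by simp
  show ?thesis
  proof (rule cont_approx_limit[OF _ _ f])
    show "L2_tendsto M s f sequentially"
      using s L2D(1)[OF f] L2_scale[OF L2_abs[OF f]]
      by (intro L2_tendsto_dominated[where w = "\<lambda>x. 2 * \<bar>f x\<bar>"])
        (auto intro: borel_measurable_simple_function)
    fix n
    have "cont_approx M (\<lambda>x. \<Sum>y\<in>s n ` UNIV. y * indicat_real (s n -` {y}) x)"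
    proof (intro cont_approx_sum cont_approx_scale cont_approx_indicator[OF metr])
      show "finite (range (s n))" using simple_functionD(1)[OF s(1)] sp by simp
      show "s n -` {y} \<in> sets M" for y using simple_functionD(2)[OF s(1), of _ "{y}"] sp by simp
    qed
    moreover have "(\<lambda>x. \<Sum>y\<in>s n ` UNIV. y * indicat_real (s n -` {y}) x) = s n"
    proof
      fix x
      show "(\<Sum>y\<in>s n ` UNIV. y * indicat_real (s n -` {y}) x) = s n x"
        using simple_function_indicator_representation_banach[OF s(1), of x n]
        unfolding sp Int_UNIV_right real_scaleR_def by (simp only: UNIV_I mult.commute[of "indicat_real _ _"])
    qed
    ultimately show "cont_approx M (s n)" by simp
  qed
qed

end

section \<open>Markov semigroups on continuous functions\<close>

text \<open>The library has this instance for metric domains only.\<close>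

instance bcontfun :: (topological_space, complete_space) complete_space
proof
  fix u :: "nat \<Rightarrow> 'a \<Rightarrow>\<^sub>C 'b"
  assume u: "Cauchy u"
  obtain l where l: "uniform_limit UNIV (\<lambda>n. apply_bcontfun (u n)) l sequentially"
  proof -
    have "uniformly_Cauchy_on UNIV (\<lambda>n. apply_bcontfun (u n))"
      unfolding uniformly_Cauchy_on_def using u
      by (meson Cauchy_def dist_fun_lt_imp_dist_val_lt)
    with that show thesis
      using Cauchy_uniformly_convergent uniformly_convergent_on_def by blast
  qed
  then obtain v where "u \<longlonglongrightarrow> v"
    by (rule uniform_limit_bcontfunE) auto
  then show "convergent u"
    by (rule convergentI)
qed

instance bcontfun :: (topological_space, banach) banach ..

text \<open>At the left endpoint only increments \<open>h > 0\<close> occur, so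
  \<open>norm (y - a)\<close> is \<open>h\<close> and the remainder in the definition of the
  derivative is the difference quotient minus \<open>d\<close>.\<close>

lemma has_vector_derivative_right_quotient:
  assumes "(F has_vector_derivative d) (at a within {a..b})" "a < b"
  shows "((\<lambda>h. (F (a + h) - F a) /\<^sub>R h) \<longlongrightarrow> d) (at_right 0)"
proof -
  have "((\<lambda>y. (F y - F a - (y - a) *\<^sub>R d) /\<^sub>R norm (y - a)) \<longlongrightarrow> 0) (at_right a)"
    using assms
    by (simp add: has_vector_derivative_def has_derivative_at_within at_within_Icc_at_right)
  then have "((\<lambda>h. (F (h + a) - F a - (h + a - a) *\<^sub>R d) /\<^sub>R norm (h + a - a)) \<longlongrightarrow> 0) (at_right 0)"
    unfolding at_right_to_0[of a] filterlim_filtermap .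
  then have "((\<lambda>h. (F (a + h) - F a) /\<^sub>R h - d) \<longlongrightarrow> 0) (at_right 0)"
  proof (rule Lim_transform_eventually)
    show "\<forall>\<^sub>F h in at_right 0. (F (h + a) - F a - (h + a - a) *\<^sub>R d) /\<^sub>R norm (h + a - a)
        = (F (a + h) - F a) /\<^sub>R h - d"
      using eventually_at_right_less[of 0]
    proof eventually_elim
      case (elim h)
      then show ?case
        by (simp add: add.commute scaleR_right_diff_distrib)
    qed
  qed
  then show ?thesis by (rule LIM_zero_cancel)
qed

text \<open>For small \<open>a\<close> the averages of this integral approximate \<open>u\<close>,
  and they belong to the domain of the generator: these are the elements from which density of that
  domain is obtained. The integral is taken in the Banach space C(Z), where the orbit is norm
  continuous.\<close>

definition orbit_integral ::
    "(real \<Rightarrow> (('z::topological_space \<Rightarrow>\<^sub>C real) \<Rightarrow>\<^sub>L ('z \<Rightarrow>\<^sub>C real))) \<Rightarrow>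
     ('z \<Rightarrow>\<^sub>C real) \<Rightarrow> real \<Rightarrow> ('z \<Rightarrow>\<^sub>C real)" where
  "orbit_integral T u a = integral {0..a} (\<lambda>s. blinfun_apply (T s) u)"

context
  fixes T :: "real \<Rightarrow> (('z::topological_space \<Rightarrow>\<^sub>C real) \<Rightarrow>\<^sub>L ('z \<Rightarrow>\<^sub>C real))"
  assumes T: "markov_semigroup T"
begin

lemma orbit_continuous: "0 \<le> a \<Longrightarrow> continuous_on {a..b} (\<lambda>s. blinfun_apply (T s) u)"
proof -
  assume "0 \<le> a"
  then have "{a..b} \<subseteq> {0..}" by auto
  with T show ?thesis
    unfolding markov_semigroup_def by (meson continuous_on_subset)
qed

lemma orbit_integral_derivative:
  assumes "0 \<le> s" "s \<le> b"
  shows "(orbit_integral T u has_vector_derivative blinfun_apply (T s) u) (at s within {0..b})"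
  unfolding orbit_integral_def
  using assms by (intro integral_has_vector_derivative orbit_continuous) auto

lemma orbit_integral_quotient:
  assumes "0 \<le> a"
  shows "((\<lambda>h. (orbit_integral T u (a + h) - orbit_integral T u a) /\<^sub>R h)
    \<longlongrightarrow> blinfun_apply (T a) u) (at_right 0)"
proof (rule has_vector_derivative_right_quotient)
  show "(orbit_integral T u has_vector_derivative blinfun_apply (T a) u) (at a within {a..a + 1})"
    by (rule has_vector_derivative_within_subset[OF orbit_integral_derivative[of a "a + 1"]])
      (use assms in auto)
qed simp

lemma orbit_integral_0: "orbit_integral T u 0 = 0"
  by (simp add: orbit_integral_def)

lemma orbit_integral_average:
  "((\<lambda>h. orbit_integral T u h /\<^sub>R h) \<longlongrightarrow> u) (at_right 0)"
  using orbit_integral_quotient[of 0 u] T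
  by (simp add: orbit_integral_0 markov_semigroup_def)

text \<open>The bounded operator \<open>T t\<close> passes under the integral, and the semigroup law
  turns the integrand into the orbit shifted by \<open>t\<close>. The shifted integral is evaluated
  by the fundamental theorem of calculus, with \<open>s \<mapsto> orbit_integral T u (t + s)\<close>
  as antiderivative.\<close>

lemma semigroup_orbit_integral:
  assumes "0 \<le> a" "0 \<le> t"
  shows "blinfun_apply (T t) (orbit_integral T u a) = orbit_integral T u (a + t) - orbit_integral T u t"
proof -
  have "((\<lambda>s. blinfun_apply (T (t + s)) u) has_integral
      orbit_integral T u (t + a) - orbit_integral T u (t + 0)) {0..a}"
  proof (rule fundamental_theorem_of_calculus[OF assms(1)])
    fix s assume s: "s \<in> {0..a}"
    have "(orbit_integral T u has_vector_derivative blinfun_apply (T (t + s)) u)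
        (at (t + s) within {0..t + a})"
      using s assms by (intro orbit_integral_derivative) auto
    then have "(orbit_integral T u has_vector_derivative blinfun_apply (T (t + s)) u)
        (at (t + s) within (\<lambda>s. t + s) ` {0..a})"
      by (rule has_vector_derivative_within_subset) (use assms in auto)
    moreover have "((\<lambda>s. t + s) has_vector_derivative 1) (at s within {0..a})"
      by (auto intro!: derivative_eq_intros)
    ultimately have "(orbit_integral T u \<circ> (\<lambda>s. t + s) has_vector_derivative
        1 *\<^sub>R blinfun_apply (T (t + s)) u) (at s within {0..a})"
      by (intro vector_diff_chain_within)
    then show "((\<lambda>s. orbit_integral T u (t + s)) has_vector_derivative
        blinfun_apply (T (t + s)) u) (at s within {0..a})"
      by (simp add: o_def)
  qed
  then have "integral {0..a} (\<lambda>s. blinfun_apply (T (t + s)) u)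
      = orbit_integral T u (a + t) - orbit_integral T u t"
    by (simp add: integral_unique add.commute)
  moreover have "integral {0..a} (\<lambda>s. blinfun_apply (T (t + s)) u)
      = integral {0..a} (\<lambda>s. blinfun_apply (T t) (blinfun_apply (T s) u))"
    using T assms(2) by (intro integral_cong) (simp add: markov_semigroup_def)
  moreover have "integral {0..a} (blinfun_apply (T t) \<circ> (\<lambda>s. blinfun_apply (T s) u))
      = blinfun_apply (T t) (orbit_integral T u a)"
    unfolding orbit_integral_def
    by (intro integral_linear integrable_continuous_real orbit_continuous blinfun.bounded_linear_right) simp
  ultimately show ?thesis by (simp add: o_def)
qed

text \<open>By \<open>semigroup_orbit_integral\<close> the quotient splits into a right difference
  quotient at \<open>a\<close>, tending to \<open>T a u\<close>, minus an average near 0, tending to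
  \<open>u\<close>.\<close>

lemma orbit_integral_generator:
  assumes "0 \<le> a"
  shows "((\<lambda>t. (blinfun_apply (T t) (orbit_integral T u a) - orbit_integral T u a) /\<^sub>R t)
    \<longlongrightarrow> blinfun_apply (T a) u - u) (at_right 0)"
proof -
  have "((\<lambda>t. (orbit_integral T u (a + t) - orbit_integral T u a) /\<^sub>R t - orbit_integral T u t /\<^sub>R t)
      \<longlongrightarrow> blinfun_apply (T a) u - u) (at_right 0)"
    by (intro tendsto_diff orbit_integral_quotient orbit_integral_average assms)
  then show ?thesis
  proof (rule Lim_transform_eventually)
    show "\<forall>\<^sub>F t in at_right 0. (orbit_integral T u (a + t) - orbit_integral T u a) /\<^sub>R t - orbit_integral T u t /\<^sub>R t
        = (blinfun_apply (T t) (orbit_integral T u a) - orbit_integral T u a) /\<^sub>R t"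
      using eventually_at_right_less[of 0]
    proof eventually_elim
      case (elim t)
      then show ?case
        by (simp add: semigroup_orbit_integral assms scaleR_right_diff_distrib)
    qed
  qed
qed

end

section \<open>Extension of Markov operators\<close>

text \<open>The extension is treated as a relation because sums, multiples and limits can then be
  formed on the approximating sequences; the value chosen in \<open>L2_extension\<close> is compared
  afterwards through uniqueness.\<close>

definition L2_extends ::
    "'z::topological_space measure \<Rightarrow> (('z \<Rightarrow>\<^sub>C real) \<Rightarrow>\<^sub>L ('z \<Rightarrow>\<^sub>C real)) \<Rightarrow>
     ('z \<Rightarrow> real) \<Rightarrow> ('z \<Rightarrow> real) \<Rightarrow> bool" where
  "L2_extends M P f h \<longleftrightarrow> f \<in> L2 M \<and> h \<in> L2 M \<and>
     (\<exists>u :: nat \<Rightarrow> ('z \<Rightarrow>\<^sub>C real).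
        L2_tendsto M (\<lambda>n. apply_bcontfun (u n)) f sequentially \<and>
        L2_tendsto M (\<lambda>n. apply_bcontfun (blinfun_apply P (u n))) h sequentially)"

text \<open>Jensen: expand \<open>P ((u - c)\<^sup>2) \<ge> 0\<close> and put \<open>c = P u x\<close>.\<close>

lemma markov_operator_square_le:
  fixes u v :: "'z::topological_space \<Rightarrow>\<^sub>C real"
  assumes P: "markov_operator P" and v: "\<And>x. apply_bcontfun v x = (apply_bcontfun u x)\<^sup>2"
  shows "(apply_bcontfun (blinfun_apply P u) x)\<^sup>2 \<le> apply_bcontfun (blinfun_apply P v) x"
proof -
  define c where "c = apply_bcontfun (blinfun_apply P u) x"
  define w where "w = v - (2 * c) *\<^sub>R u + c\<^sup>2 *\<^sub>R const_bcontfun 1"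
  have "apply_bcontfun w y = (apply_bcontfun u y - c)\<^sup>2" for y
    by (simp add: w_def v const_bcontfun.rep_eq power2_diff mult.commute)
  then have "0 \<le> apply_bcontfun (blinfun_apply P w) x"
    using P by (simp add: markov_operator_def)
  also have "blinfun_apply P w = blinfun_apply P v - (2 * c) *\<^sub>R blinfun_apply P u + c\<^sup>2 *\<^sub>R const_bcontfun 1"
    using P by (simp add: w_def markov_operator_def blinfun.add_right blinfun.diff_right blinfun.scaleR_right)
  finally show ?thesis
    by (simp add: const_bcontfun.rep_eq power2_eq_square flip: c_def)
qed

context
  fixes M :: "'z::topological_space measure" and P :: "('z \<Rightarrow>\<^sub>C real) \<Rightarrow>\<^sub>L ('z \<Rightarrow>\<^sub>C real)"
  assumes M: "prob_space M" "sets M = sets borel"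
    and metr: "metrizable_space (euclidean :: 'z topology)"
    and P: "markov_operator P"
    and inv: "\<And>g. (\<integral>x. apply_bcontfun (blinfun_apply P g) x \<partial>M) = (\<integral>x. apply_bcontfun g x \<partial>M)"
begin

text \<open>Integrate the pointwise inequality \<open>(P u)^2 <= P (u^2)\<close> and use invariance
  of the measure on the right.\<close>

lemma markov_L2_contraction:
  "L2_norm M (apply_bcontfun (blinfun_apply P u)) \<le> L2_norm M (apply_bcontfun u)"
proof -
  \<comment> \<open>\<open>P\<close> acts only on elements of C(Z), so the square of
    \<open>u\<close> must first be packaged as such an element \<open>v\<close>.\<close>
  have "(\<lambda>x. (apply_bcontfun u x)\<^sup>2) \<in> bcontfun"
  proof (rule bcontfun_normI)
    show "continuous_on UNIV (\<lambda>x. (apply_bcontfun u x)\<^sup>2)"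
      by (intro continuous_intros) simp
    show "norm ((apply_bcontfun u x)\<^sup>2) \<le> (norm u)\<^sup>2" for x
      using power_mono[OF norm_bounded[of u x], of 2] by simp
  qed
  then obtain v where v: "apply_bcontfun v = (\<lambda>x. (apply_bcontfun u x)\<^sup>2)"
    using Bcontfun_inverse by blast
  have int: "integrable M (apply_bcontfun w)" for w :: "'z \<Rightarrow>\<^sub>C real"
    using integrable_mult_L2[OF continuous_L2[OF M, of w] L2_const[OF M(1), of 1]] by simp
  have "L2_inner M (apply_bcontfun (blinfun_apply P u)) (apply_bcontfun (blinfun_apply P u))
      \<le> (\<integral>x. apply_bcontfun (blinfun_apply P v) x \<partial>M)"
    unfolding L2_inner_def
  proof (rule integral_mono)
    show "integrable M (\<lambda>x. apply_bcontfun (blinfun_apply P u) x * apply_bcontfun (blinfun_apply P u) x)"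
      by (intro integrable_mult_L2 continuous_L2[OF M])
    show "apply_bcontfun (blinfun_apply P u) x * apply_bcontfun (blinfun_apply P u) x
        \<le> apply_bcontfun (blinfun_apply P v) x" for x
      using markov_operator_square_le[OF P, of v u x] v by (simp add: power2_eq_square)
  qed (rule int)
  then show ?thesis
    unfolding inv v L2_norm_def by (simp add: L2_inner_def power2_eq_square)
qed

lemma L2_extends_continuous:
  "L2_extends M P (apply_bcontfun u) (apply_bcontfun (blinfun_apply P u))"
  unfolding L2_extends_def
  using continuous_L2[OF M] by (intro conjI exI[of _ "\<lambda>_. u"]) simp_all

text \<open>Density gives continuous \<open>u n\<close> tending to \<open>f\<close>. By contraction
  the images \<open>P (u n)\<close> inherit the Cauchy property, and completeness provides the
  limit.\<close>

lemma L2_extends_exists: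
  assumes f: "f \<in> L2 M"
  shows "\<exists>h. L2_extends M P f h"
proof -
  have "\<exists>u :: nat \<Rightarrow> 'z \<Rightarrow>\<^sub>C real. \<forall>n. L2_norm M (\<lambda>x. f x - apply_bcontfun (u n) x) < 1 / Suc n"
    by (rule choice, rule allI, rule cont_approxD[OF cont_approx_L2[OF M metr f]]) simp
  then obtain u :: "nat \<Rightarrow> 'z \<Rightarrow>\<^sub>C real"
    where u: "\<And>n. L2_norm M (\<lambda>x. f x - apply_bcontfun (u n) x) < 1 / Suc n"
    by blast
  have cL: "apply_bcontfun w \<in> L2 M" for w :: "'z \<Rightarrow>\<^sub>C real"
    by (rule continuous_L2[OF M])
  have lim: "L2_tendsto M (\<lambda>n. apply_bcontfun (u n)) f sequentially"
  proof (rule L2_tendsto_bound)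
    show "\<forall>\<^sub>F n in sequentially. L2_norm M (\<lambda>x. apply_bcontfun (u n) x - f x) \<le> 1 / Suc n"
      using u by (intro always_eventually allI) (simp add: L2_norm_diff_commute[of M _ f] less_imp_le)
    show "(\<lambda>n. 1 / Suc n) \<longlonglongrightarrow> 0"
      using LIMSEQ_inverse_real_of_nat by (simp add: inverse_eq_divide)
  qed
  obtain h where h: "h \<in> L2 M" "L2_tendsto M (\<lambda>n. apply_bcontfun (blinfun_apply P (u n))) h sequentially"
  proof (rule L2_complete[OF M(1) cL])
    fix e :: real assume "e > 0"
    then have "\<forall>\<^sub>F n in sequentially. L2_norm M (\<lambda>x. apply_bcontfun (u n) x - f x) < e / 2"
      using L2_tendstoD[OF lim] by (intro order_tendstoD(2)) auto
    then obtain N where N: "\<And>n. n \<ge> N \<Longrightarrow> L2_norm M (\<lambda>x. apply_bcontfun (u n) x - f x) < e / 2"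
      by (auto simp: eventually_sequentially)
    have "L2_norm M (\<lambda>x. apply_bcontfun (blinfun_apply P (u m)) x - apply_bcontfun (blinfun_apply P (u n)) x) < e"
      if "m \<ge> N" "n \<ge> N" for m n
    proof -
      have "L2_norm M (\<lambda>x. apply_bcontfun (blinfun_apply P (u m)) x - apply_bcontfun (blinfun_apply P (u n)) x)
          \<le> L2_norm M (\<lambda>x. apply_bcontfun (u m) x - apply_bcontfun (u n) x)"
        using markov_L2_contraction[of "u m - u n"] by (simp add: blinfun.diff_right)
      also have "\<dots> \<le> L2_norm M (\<lambda>x. apply_bcontfun (u m) x - f x)
          + L2_norm M (\<lambda>x. f x - apply_bcontfun (u n) x)"
        by (rule L2_norm_diff_triangle[OF cL f cL])
      also have "\<dots> < e"
        using N[OF that(1)] N[OF that(2)] by (simp add: L2_norm_diff_commute[of M f])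
      finally show ?thesis .
    qed
    then show "\<exists>N. \<forall>m\<ge>N. \<forall>n\<ge>N. L2_norm M (\<lambda>x. apply_bcontfun (blinfun_apply P (u m)) x -
        apply_bcontfun (blinfun_apply P (u n)) x) < e"
      by blast
  qed
  with f lim show ?thesis
    unfolding L2_extends_def by blast
qed

lemma L2_extends_add:
  assumes "L2_extends M P f h" "L2_extends M P g k"
  shows "L2_extends M P (\<lambda>x. f x + g x) (\<lambda>x. h x + k x)"
proof -
  obtain u v :: "nat \<Rightarrow> 'z \<Rightarrow>\<^sub>C real" where
    u: "L2_tendsto M (\<lambda>n. apply_bcontfun (u n)) f sequentially"
      "L2_tendsto M (\<lambda>n. apply_bcontfun (blinfun_apply P (u n))) h sequentially" and
    v: "L2_tendsto M (\<lambda>n. apply_bcontfun (v n)) g sequentially"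
      "L2_tendsto M (\<lambda>n. apply_bcontfun (blinfun_apply P (v n))) k sequentially"
    using assms unfolding L2_extends_def by blast
  have mem: "f \<in> L2 M" "h \<in> L2 M" "g \<in> L2 M" "k \<in> L2 M"
    using assms unfolding L2_extends_def by blast+
  have "L2_tendsto M (\<lambda>n. apply_bcontfun (u n + v n)) (\<lambda>x. f x + g x) sequentially"
    using L2_tendsto_add[OF u(1) v(1)] mem continuous_L2[OF M] by simp
  moreover have "L2_tendsto M (\<lambda>n. apply_bcontfun (blinfun_apply P (u n + v n))) (\<lambda>x. h x + k x) sequentially"
    using L2_tendsto_add[OF u(2) v(2)] mem continuous_L2[OF M] by (simp add: blinfun.add_right)
  ultimately show ?thesis
    unfolding L2_extends_def using mem
    by (intro conjI exI[of _ "\<lambda>n. u n + v n"]) simp_all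
qed

lemma L2_extends_scale:
  assumes "L2_extends M P f h"
  shows "L2_extends M P (\<lambda>x. c * f x) (\<lambda>x. c * h x)"
proof -
  obtain u :: "nat \<Rightarrow> 'z \<Rightarrow>\<^sub>C real" where
    u: "L2_tendsto M (\<lambda>n. apply_bcontfun (u n)) f sequentially"
      "L2_tendsto M (\<lambda>n. apply_bcontfun (blinfun_apply P (u n))) h sequentially"
    using assms unfolding L2_extends_def by blast
  have mem: "f \<in> L2 M" "h \<in> L2 M"
    using assms unfolding L2_extends_def by blast+
  have "L2_tendsto M (\<lambda>n. apply_bcontfun (c *\<^sub>R u n)) (\<lambda>x. c * f x) sequentially"
    using L2_tendsto_scale[OF u(1), of c] by simp
  moreover have "L2_tendsto M (\<lambda>n. apply_bcontfun (blinfun_apply P (c *\<^sub>R u n))) (\<lambda>x. c * h x) sequentially"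
    using L2_tendsto_scale[OF u(2), of c] by (simp add: blinfun.scaleR_right)
  ultimately show ?thesis
    unfolding L2_extends_def using mem
    by (intro conjI exI[of _ "\<lambda>n. c *\<^sub>R u n"]) simp_all
qed

lemma L2_extends_norm_le:
  assumes "L2_extends M P f h"
  shows "L2_norm M h \<le> L2_norm M f"
proof -
  obtain u :: "nat \<Rightarrow> 'z \<Rightarrow>\<^sub>C real" where
    u: "L2_tendsto M (\<lambda>n. apply_bcontfun (u n)) f sequentially"
      "L2_tendsto M (\<lambda>n. apply_bcontfun (blinfun_apply P (u n))) h sequentially"
    using assms unfolding L2_extends_def by blast
  have mem: "f \<in> L2 M" "h \<in> L2 M"
    using assms unfolding L2_extends_def by blast+
  have "(\<lambda>n. L2_norm M (apply_bcontfun (u n))) \<longlonglongrightarrow> L2_norm M f"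
    using continuous_L2[OF M] mem by (intro L2_tendsto_norm[OF u(1)]) auto
  moreover have "(\<lambda>n. L2_norm M (apply_bcontfun (blinfun_apply P (u n)))) \<longlonglongrightarrow> L2_norm M h"
    using continuous_L2[OF M] mem by (intro L2_tendsto_norm[OF u(2)]) auto
  ultimately show ?thesis
    using markov_L2_contraction by (intro LIMSEQ_le) auto
qed

lemma L2_extends_integral:
  assumes "L2_extends M P f h"
  shows "L2_inner M h (\<lambda>x. 1) = L2_inner M f (\<lambda>x. 1)"
proof -
  obtain u :: "nat \<Rightarrow> 'z \<Rightarrow>\<^sub>C real" where
    u: "L2_tendsto M (\<lambda>n. apply_bcontfun (u n)) f sequentially"
      "L2_tendsto M (\<lambda>n. apply_bcontfun (blinfun_apply P (u n))) h sequentially"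
    using assms unfolding L2_extends_def by blast
  have mem: "f \<in> L2 M" "h \<in> L2 M"
    using assms unfolding L2_extends_def by blast+
  have one: "(\<lambda>x. 1) \<in> L2 M" by (rule L2_const[OF M(1)])
  have "(\<lambda>n. L2_inner M (apply_bcontfun (u n)) (\<lambda>x. 1)) \<longlonglongrightarrow> L2_inner M f (\<lambda>x. 1)"
    using continuous_L2[OF M] mem one by (intro L2_tendsto_inner[OF u(1)]) auto
  moreover have "(\<lambda>n. L2_inner M (apply_bcontfun (blinfun_apply P (u n))) (\<lambda>x. 1)) \<longlonglongrightarrow> L2_inner M h (\<lambda>x. 1)"
    using continuous_L2[OF M] mem one by (intro L2_tendsto_inner[OF u(2)]) auto
  moreover have "L2_inner M (apply_bcontfun (blinfun_apply P (u n))) (\<lambda>x. 1)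
      = L2_inner M (apply_bcontfun (u n)) (\<lambda>x. 1)" for n
    using inv[of "u n"] by (simp add: L2_inner_def)
  ultimately show ?thesis
    using LIMSEQ_unique by auto
qed

text \<open>The difference of the two pairs is again related by \<open>P\<close>, and contraction
  bounds the norm of \<open>h - k\<close> by that of \<open>f - g\<close>, which is 0.\<close>

lemma L2_extends_unique:
  assumes "L2_extends M P f h" "L2_extends M P g k" "L2_eq M f g"
  shows "L2_eq M h k"
proof -
  have "L2_extends M P (\<lambda>x. f x + -1 * g x) (\<lambda>x. h x + -1 * k x)"
    by (intro L2_extends_add L2_extends_scale assms)
  from L2_extends_norm_le[OF this] have "L2_norm M (\<lambda>x. h x - k x) \<le> L2_norm M (\<lambda>x. f x - g x)"
    by simp
  also have "\<dots> = 0"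
    using assms(3) by (simp add: L2_eq_def)
  finally show ?thesis
    using assms L2_norm_nonneg[of M "\<lambda>x. h x - k x"] by (simp add: L2_eq_def L2_extends_def)
qed

lemma L2_extension:
  assumes f: "f \<in> L2 M"
  shows "L2_extends M P f (L2_extension M P f)"
proof -
  have "\<exists>h. h \<in> L2 M \<and> (\<exists>u :: nat \<Rightarrow> ('z \<Rightarrow>\<^sub>C real).
        L2_tendsto M (\<lambda>n. apply_bcontfun (u n)) f sequentially \<and>
        L2_tendsto M (\<lambda>n. apply_bcontfun (blinfun_apply P (u n))) h sequentially)"
    using L2_extends_exists[OF f] unfolding L2_extends_def by blast
  from someI_ex[OF this] f show ?thesis
    unfolding L2_extends_def L2_extension_def by blast
qed

end

section \<open>Generators of contraction families\<close>

text \<open>This is a densely defined linear operator on L2, written for representatives: the two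
  congruence axioms say that it acts on classes, and linearity is asserted only up to
  \<open>L2_eq\<close>.\<close>

locale L2_operator =
  fixes M :: "'z measure" and D :: "('z \<Rightarrow> real) set" and A :: "('z \<Rightarrow> real) \<Rightarrow> ('z \<Rightarrow> real)"
  assumes prob: "prob_space M"
    and dom: "\<And>f. f \<in> D \<Longrightarrow> f \<in> L2 M"
    and mem: "\<And>f. f \<in> D \<Longrightarrow> A f \<in> L2 M"
    and dom_cong: "\<And>f g. f \<in> D \<Longrightarrow> L2_eq M f g \<Longrightarrow> g \<in> D"
    and cong: "\<And>f g. f \<in> D \<Longrightarrow> L2_eq M f g \<Longrightarrow> L2_eq M (A f) (A g)"
    and dom_add: "\<And>f g. f \<in> D \<Longrightarrow> g \<in> D \<Longrightarrow> (\<lambda>x. f x + g x) \<in> D"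
    and add: "\<And>f g. f \<in> D \<Longrightarrow> g \<in> D \<Longrightarrow> L2_eq M (A (\<lambda>x. f x + g x)) (\<lambda>x. A f x + A g x)"
    and dom_scale: "\<And>f c. f \<in> D \<Longrightarrow> (\<lambda>x. c * f x) \<in> D"
    and scale: "\<And>f c. f \<in> D \<Longrightarrow> L2_eq M (A (\<lambda>x. c * f x)) (\<lambda>x. c * A f x)"
    and dense: "\<And>f e. f \<in> L2 M \<Longrightarrow> 0 < e \<Longrightarrow> \<exists>g\<in>D. L2_norm M (\<lambda>x. f x - g x) < e"

text \<open>The conditions concern \<open>t > 0\<close> because the generator is a limit at 0 from
  the right. Invariance of the integral and of the constant 1 later yield
  \<open>(A f, 1) = 0\<close> and \<open>A 1 = 0\<close>.\<close>

locale L2_contractions =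
  fixes M :: "'z measure" and S :: "real \<Rightarrow> ('z \<Rightarrow> real) \<Rightarrow> ('z \<Rightarrow> real)"
  assumes prob: "prob_space M"
    and S_mem: "\<And>t f. 0 < t \<Longrightarrow> f \<in> L2 M \<Longrightarrow> S t f \<in> L2 M"
    and S_cong: "\<And>t f g. 0 < t \<Longrightarrow> L2_eq M f g \<Longrightarrow> L2_eq M (S t f) (S t g)"
    and S_add: "\<And>t f g. 0 < t \<Longrightarrow> f \<in> L2 M \<Longrightarrow> g \<in> L2 M \<Longrightarrow>
      L2_eq M (S t (\<lambda>x. f x + g x)) (\<lambda>x. S t f x + S t g x)"
    and S_scale: "\<And>t f c. 0 < t \<Longrightarrow> f \<in> L2 M \<Longrightarrow> L2_eq M (S t (\<lambda>x. c * f x)) (\<lambda>x. c * S t f x)"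
    and S_norm: "\<And>t f. 0 < t \<Longrightarrow> f \<in> L2 M \<Longrightarrow> L2_norm M (S t f) \<le> L2_norm M f"
    and S_integral: "\<And>t f. 0 < t \<Longrightarrow> f \<in> L2 M \<Longrightarrow>
      L2_inner M (S t f) (\<lambda>x. 1) = L2_inner M f (\<lambda>x. 1)"
    and S_one: "\<And>t. 0 < t \<Longrightarrow> L2_eq M (S t (\<lambda>x. 1)) (\<lambda>x. 1)"
begin

lemma eventually_pos: "\<forall>\<^sub>F t in at_right (0::real). 0 < t"
  by (rule eventually_at_right_less)

lemma eventually_quotient_mem:
  "f \<in> L2 M \<Longrightarrow> \<forall>\<^sub>F t in at_right 0. (\<lambda>x. (S t f x - f x) / t) \<in> L2 M"
  using eventually_pos by eventually_elim (simp add: S_mem)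

lemma generator_value_unique:
  assumes "is_generator_value M S f h" "is_generator_value M S f k"
  shows "L2_eq M h k"
  using assms eventually_quotient_mem unfolding is_generator_value_def
  by (intro L2_tendsto_unique[of M _ h "at_right 0" k]) auto

lemma generator_value_cong:
  assumes "is_generator_value M S f h" "L2_eq M f g" "L2_eq M h k"
  shows "is_generator_value M S g k"
  unfolding is_generator_value_def
proof (intro conjI)
  show "g \<in> L2 M" "k \<in> L2 M" using assms by (auto dest: L2_eq_mem)
  have "\<forall>\<^sub>F t in at_right 0. L2_eq M (\<lambda>x. (S t f x - f x) / t) (\<lambda>x. (S t g x - g x) / t)"
    using eventually_pos
    by eventually_elim (intro L2_eq_divide L2_eq_diff S_cong assms(2))
  with assms(1,3) show "L2_tendsto M (\<lambda>t x. (S t g x - g x) / t) k (at_right 0)"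
    unfolding is_generator_value_def by (blast intro: L2_tendsto_cong)
qed

lemma generator_value_add:
  assumes "is_generator_value M S f h" "is_generator_value M S g k"
  shows "is_generator_value M S (\<lambda>x. f x + g x) (\<lambda>x. h x + k x)"
  unfolding is_generator_value_def
proof (intro conjI)
  have mem: "f \<in> L2 M" "g \<in> L2 M" "h \<in> L2 M" "k \<in> L2 M"
    using assms by (auto simp: is_generator_value_def)
  then show "(\<lambda>x. f x + g x) \<in> L2 M" "(\<lambda>x. h x + k x) \<in> L2 M" by simp_all
  have "L2_tendsto M (\<lambda>t x. (S t f x - f x) / t + (S t g x - g x) / t) (\<lambda>x. h x + k x) (at_right 0)"
    using assms mem eventually_quotient_mem
    by (intro L2_tendsto_add) (auto simp: is_generator_value_def eventually_conj_iff)
  then show "L2_tendsto M (\<lambda>t x. (S t (\<lambda>x. f x + g x) x - (f x + g x)) / t) (\<lambda>x. h x + k x) (at_right 0)"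
  proof (rule L2_tendsto_cong)
    show "\<forall>\<^sub>F t in at_right 0. L2_eq M (\<lambda>x. (S t f x - f x) / t + (S t g x - g x) / t)
        (\<lambda>x. (S t (\<lambda>x. f x + g x) x - (f x + g x)) / t)"
      using eventually_pos
    proof eventually_elim
      case (elim t)
      have "L2_eq M (\<lambda>x. ((S t f x + S t g x) - (f x + g x)) / t)
          (\<lambda>x. (S t (\<lambda>x. f x + g x) x - (f x + g x)) / t)"
        using mem by (intro L2_eq_divide L2_eq_diff L2_eq_sym[OF S_add] elim) auto
      then show ?case
        by (simp add: add_diff_add add_divide_distrib)
    qed
  qed (use mem in simp)
qed

lemma generator_value_scale:
  assumes "is_generator_value M S f h"
  shows "is_generator_value M S (\<lambda>x. c * f x) (\<lambda>x. c * h x)"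
  unfolding is_generator_value_def
proof (intro conjI)
  have mem: "f \<in> L2 M" "h \<in> L2 M"
    using assms by (auto simp: is_generator_value_def)
  then show "(\<lambda>x. c * f x) \<in> L2 M" "(\<lambda>x. c * h x) \<in> L2 M" by simp_all
  have "L2_tendsto M (\<lambda>t x. c * ((S t f x - f x) / t)) (\<lambda>x. c * h x) (at_right 0)"
    using assms by (intro L2_tendsto_scale) (auto simp: is_generator_value_def)
  then show "L2_tendsto M (\<lambda>t x. (S t (\<lambda>x. c * f x) x - c * f x) / t) (\<lambda>x. c * h x) (at_right 0)"
  proof (rule L2_tendsto_cong)
    show "\<forall>\<^sub>F t in at_right 0. L2_eq M (\<lambda>x. c * ((S t f x - f x) / t))
        (\<lambda>x. (S t (\<lambda>x. c * f x) x - c * f x) / t)"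
      using eventually_pos
    proof eventually_elim
      case (elim t)
      have "L2_eq M (\<lambda>x. (c * S t f x - c * f x) / t) (\<lambda>x. (S t (\<lambda>x. c * f x) x - c * f x) / t)"
        using mem by (intro L2_eq_divide L2_eq_diff L2_eq_sym[OF S_scale] elim) auto
      then show ?case
        by (simp add: right_diff_distrib)
    qed
  qed (use mem in simp)
qed

text \<open>Cauchy-Schwarz and contraction give \<open>(S t f, f) <= (f, f)\<close>, so every
  difference quotient has nonpositive scalar product with \<open>f\<close>; the sign survives the
  limit.\<close>

lemma generator_value_dissipative:
  assumes "is_generator_value M S f h"
  shows "L2_inner M h f \<le> 0"
proof -
  have mem: "f \<in> L2 M" "h \<in> L2 M"
    and lim: "L2_tendsto M (\<lambda>t x. (S t f x - f x) / t) h (at_right 0)"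
    using assms by (auto simp: is_generator_value_def)
  have "((\<lambda>t. L2_inner M (\<lambda>x. (S t f x - f x) / t) f) \<longlongrightarrow> L2_inner M h f) (at_right 0)"
    using mem eventually_quotient_mem by (intro L2_tendsto_inner[OF lim]) auto
  moreover have "\<forall>\<^sub>F t in at_right 0. L2_inner M (\<lambda>x. (S t f x - f x) / t) f \<le> 0"
    using eventually_pos
  proof eventually_elim
    case (elim t)
    have "L2_inner M (S t f) f \<le> L2_norm M (S t f) * L2_norm M f"
      using L2_Cauchy_Schwarz[OF S_mem[OF elim mem(1)] mem(1)] by simp
    also have "\<dots> \<le> L2_norm M f * L2_norm M f"
      by (intro mult_right_mono S_norm elim mem) simp
    also have "\<dots> = L2_inner M f f"
      by (simp add: L2_norm_power2 flip: power2_eq_square)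
    finally show ?case
      using elim mem by (simp add: S_mem divide_nonpos_pos)
  qed
  ultimately show ?thesis
    by (intro tendsto_upperbound) auto
qed

lemma generator_value_integral:
  assumes "is_generator_value M S f h"
  shows "L2_inner M h (\<lambda>x. 1) = 0"
proof -
  have mem: "f \<in> L2 M" "h \<in> L2 M"
    and lim: "L2_tendsto M (\<lambda>t x. (S t f x - f x) / t) h (at_right 0)"
    using assms by (auto simp: is_generator_value_def)
  have one: "(\<lambda>x. 1) \<in> L2 M" by (rule L2_const[OF prob])
  have "((\<lambda>t. L2_inner M (\<lambda>x. (S t f x - f x) / t) (\<lambda>x. 1)) \<longlongrightarrow> L2_inner M h (\<lambda>x. 1)) (at_right 0)"
    using mem one eventually_quotient_mem by (intro L2_tendsto_inner[OF lim]) auto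
  moreover have "\<forall>\<^sub>F t in at_right 0. L2_inner M (\<lambda>x. (S t f x - f x) / t) (\<lambda>x. 1) = 0"
    using eventually_pos
    by eventually_elim (simp add: S_mem mem one S_integral)
  ultimately have "((\<lambda>t. 0) \<longlongrightarrow> L2_inner M h (\<lambda>x. 1)) (at_right (0::real))"
    by (rule Lim_transform_eventually)
  then show ?thesis
    by (simp add: tendsto_const_iff)
qed

lemma generator_value_one: "is_generator_value M S (\<lambda>x. 1) (\<lambda>x. 0)"
  unfolding is_generator_value_def
proof (intro conjI)
  show one: "(\<lambda>x. 1) \<in> L2 M" by (rule L2_const[OF prob])
  show "L2_tendsto M (\<lambda>t x. (S t (\<lambda>x. 1) x - 1) / t) (\<lambda>x. 0) (at_right 0)"
  proof (rule L2_tendsto_cong[OF L2_tendsto_const])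
    show "\<forall>\<^sub>F t in at_right 0. L2_eq M (\<lambda>x. 0) (\<lambda>x. (S t (\<lambda>x. 1) x - 1) / t)"
      using eventually_pos
    proof eventually_elim
      case (elim t)
      have "L2_eq M (\<lambda>x. (1 - 1) / t) (\<lambda>x. (S t (\<lambda>x. 1) x - 1) / t)"
        by (intro L2_eq_divide L2_eq_diff L2_eq_sym[OF S_one] elim L2_eq_refl one)
      then show ?case by simp
    qed
  qed simp
qed simp

abbreviation "A \<equiv> generator M S"
abbreviation "D \<equiv> generator_dom M S"

lemma generator_value: "f \<in> D \<Longrightarrow> is_generator_value M S f (A f)"
  unfolding generator_dom_def generator_def mem_Collect_eq
  by (rule someI_ex[where P = "is_generator_value M S f"])

lemma generator_domI: "is_generator_value M S f h \<Longrightarrow> f \<in> D"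
  by (auto simp: generator_dom_def)

lemma generator_eqI: "is_generator_value M S f h \<Longrightarrow> L2_eq M (A f) h"
  by (rule generator_value_unique[OF generator_value[OF generator_domI]])

text \<open>Density stays a hypothesis here, since its proof uses orbits of continuous functions,
  which an abstract contraction family does not have.\<close>

lemma generator_L2_operator:
  assumes dense: "\<And>f e. f \<in> L2 M \<Longrightarrow> 0 < e \<Longrightarrow> \<exists>g\<in>D. L2_norm M (\<lambda>x. f x - g x) < e"
  shows "L2_operator M D A"
proof (rule L2_operator.intro)
  show "prob_space M" by (rule prob)
next
  fix f assume f: "f \<in> D"
  show "f \<in> L2 M" "A f \<in> L2 M"
    using generator_value[OF f] by (auto simp: is_generator_value_def)
next
  fix f g assume f: "f \<in> D" and fg: "L2_eq M f g"
  have "A f \<in> L2 M"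
    using generator_value[OF f] by (auto simp: is_generator_value_def)
  from generator_value_cong[OF generator_value[OF f] fg L2_eq_refl[OF this]]
  show "g \<in> D" "L2_eq M (A f) (A g)"
    by (rule generator_domI, rule L2_eq_sym[OF generator_eqI])
next
  fix f g assume "f \<in> D" "g \<in> D"
  from generator_value_add[OF this[THEN generator_value]]
  show "(\<lambda>x. f x + g x) \<in> D" "L2_eq M (A (\<lambda>x. f x + g x)) (\<lambda>x. A f x + A g x)"
    by (rule generator_domI, rule generator_eqI)
next
  fix f and c :: real assume "f \<in> D"
  from generator_value_scale[OF generator_value[OF this]]
  show "(\<lambda>x. c * f x) \<in> D" "L2_eq M (A (\<lambda>x. c * f x)) (\<lambda>x. c * A f x)"
    by (rule generator_domI, rule generator_eqI)
qed (rule dense)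

end

section \<open>Normal operators\<close>

context L2_operator
begin

lemma dom_diff: "f \<in> D \<Longrightarrow> g \<in> D \<Longrightarrow> (\<lambda>x. f x - g x) \<in> D"
  using dom_add[OF _ dom_scale[of g "-1"], of f] by simp

lemma diff:
  assumes "f \<in> D" "g \<in> D"
  shows "L2_eq M (A (\<lambda>x. f x - g x)) (\<lambda>x. A f x - A g x)"
proof -
  have "L2_eq M (A (\<lambda>x. f x + -1 * g x)) (\<lambda>x. A f x + A (\<lambda>x. -1 * g x) x)"
    by (intro add dom_scale assms)
  also have "L2_eq M \<dots> (\<lambda>x. A f x + -1 * A g x)"
    by (intro L2_eq_add L2_eq_refl mem scale assms)
  finally show ?thesis by simp
qed

text \<open>If \<open>f\<close> had positive norm, some \<open>g\<close> in \<open>D\<close> would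
  be closer to \<open>f\<close> than that norm, and orthogonality would give
  \<open>(f, f) = (f - g, f) < (f, f)\<close>.\<close>

lemma orthogonal_eq_zero:
  assumes f: "f \<in> L2 M" and orth: "\<And>g. g \<in> D \<Longrightarrow> L2_inner M g f = 0"
  shows "L2_norm M f = 0"
proof (rule ccontr)
  assume "L2_norm M f \<noteq> 0"
  then have pos: "0 < L2_norm M f"
    using L2_norm_nonneg[of M f] by linarith
  from dense[OF f this] obtain g where g: "g \<in> D" "L2_norm M (\<lambda>x. f x - g x) < L2_norm M f"
    by blast
  have "L2_inner M f f = L2_inner M (\<lambda>x. f x - g x) f"
    using orth[OF g(1)] dom[OF g(1)] f by simp
  also have "\<dots> \<le> L2_norm M (\<lambda>x. f x - g x) * L2_norm M f"
    using L2_Cauchy_Schwarz[of "\<lambda>x. f x - g x" M f] dom[OF g(1)] f by simp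
  also have "\<dots> < L2_norm M f * L2_norm M f"
    using g(2) pos by (rule mult_strict_right_mono)
  finally show False
    by (simp add: L2_norm_power2 flip: power2_eq_square)
qed

lemma orthogonal_eq:
  assumes "f \<in> L2 M" "h \<in> L2 M" "\<And>g. g \<in> D \<Longrightarrow> L2_inner M g f = L2_inner M g h"
  shows "L2_eq M f h"
  using orthogonal_eq_zero[of "\<lambda>x. f x - h x"] assms by (simp add: L2_eq_def dom)

end

locale normal_L2_operator = L2_operator +
  assumes normal: "normal_op M D A"
begin

abbreviation "B \<equiv> adjoint_op M D A"

lemma adjoint_value:
  assumes "f \<in> D"
  shows "is_adjoint_value M D A f (B f)"
proof -
  have "D = adjoint_dom M D A"
    using normal unfolding normal_op_def by blast
  with assms have "f \<in> adjoint_dom M D A" by blast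
  then have "\<exists>h. is_adjoint_value M D A f h"
    unfolding adjoint_dom_def by blast
  then show ?thesis
    unfolding adjoint_op_def by (rule someI_ex[where P = "is_adjoint_value M D A f"])
qed

text \<open>Normality makes \<open>D\<close> the full domain of the adjoint, so exhibiting any
  adjoint value proves membership in \<open>D\<close>. Both \<open>closed_operator\<close> and
  \<open>biadjoint\<close> rely on this.\<close>

lemma adjoint_domI: "is_adjoint_value M D A f h \<Longrightarrow> f \<in> D"
  using normal unfolding normal_op_def adjoint_dom_def by blast

text \<open>Two adjoint values have the same scalar products with the dense set \<open>D\<close>, so
  they agree.\<close>

lemma adjoint_eqI:
  assumes "is_adjoint_value M D A f h"
  shows "L2_eq M (B f) h"
  using assms adjoint_value[OF adjoint_domI[OF assms]]
  by (intro orthogonal_eq) (simp_all add: is_adjoint_value_def)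

lemma adjoint_mem: "f \<in> D \<Longrightarrow> B f \<in> L2 M"
  using adjoint_value by (simp add: is_adjoint_value_def)

lemma adjoint: "f \<in> D \<Longrightarrow> g \<in> D \<Longrightarrow> L2_inner M (A g) f = L2_inner M g (B f)"
  using adjoint_value by (simp add: is_adjoint_value_def)

lemma adjoint_norm: "f \<in> D \<Longrightarrow> L2_norm M (A f) = L2_norm M (B f)"
  using normal by (simp add: normal_op_def)

text \<open>Each property of \<open>B\<close> is obtained by checking that the expected result is an
  adjoint value and invoking uniqueness. This makes the linearity rules available for
  \<open>B\<close> as well.\<close>

sublocale adj: L2_operator M D B
proof (rule L2_operator.intro)
  show "prob_space M" by (rule prob)
next
  fix f assume f: "f \<in> D"
  show "f \<in> L2 M" "B f \<in> L2 M" by (rule dom[OF f], rule adjoint_mem[OF f])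
next
  fix f g assume f: "f \<in> D" and fg: "L2_eq M f g"
  show "g \<in> D" by (rule dom_cong[OF f fg])
  have "is_adjoint_value M D A g (B f)"
    using adjoint_value[OF f] L2_eq_inner_right[OF fg mem] L2_eq_mem[OF fg]
    by (simp add: is_adjoint_value_def)
  then show "L2_eq M (B f) (B g)" by (rule L2_eq_sym[OF adjoint_eqI])
next
  fix f g assume fg: "f \<in> D" "g \<in> D"
  show "(\<lambda>x. f x + g x) \<in> D" by (rule dom_add[OF fg])
  have "is_adjoint_value M D A (\<lambda>x. f x + g x) (\<lambda>x. B f x + B g x)"
    using fg by (simp add: is_adjoint_value_def dom mem adjoint_mem adjoint)
  then show "L2_eq M (B (\<lambda>x. f x + g x)) (\<lambda>x. B f x + B g x)" by (rule adjoint_eqI)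
next
  fix f and c :: real assume f: "f \<in> D"
  show "(\<lambda>x. c * f x) \<in> D" by (rule dom_scale[OF f])
  have "is_adjoint_value M D A (\<lambda>x. c * f x) (\<lambda>x. c * B f x)"
    using f by (simp add: is_adjoint_value_def dom adjoint_mem adjoint)
  then show "L2_eq M (B (\<lambda>x. c * f x)) (\<lambda>x. c * B f x)" by (rule adjoint_eqI)
qed (rule dense)

lemma adjoint_norm_diff:
  assumes "f \<in> D" "g \<in> D"
  shows "L2_norm M (\<lambda>x. A f x - A g x) = L2_norm M (\<lambda>x. B f x - B g x)"
  using adjoint_norm[OF dom_diff[OF assms]] L2_eq_norm[OF diff[OF assms]]
    L2_eq_norm[OF adj.diff[OF assms]] by simp

text \<open>Polarization: equality of norms for \<open>f\<close>, \<open>g\<close> and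
  \<open>f - g\<close> determines the scalar product.\<close>

lemma adjoint_inner:
  assumes fg: "f \<in> D" "g \<in> D"
  shows "L2_inner M (A f) (A g) = L2_inner M (B f) (B g)"
proof -
  have "(L2_norm M (\<lambda>x. A f x - A g x))\<^sup>2 = (L2_norm M (\<lambda>x. B f x - B g x))\<^sup>2"
    using adjoint_norm_diff[OF fg] by simp
  moreover have "L2_inner M (A f) (A f) = L2_inner M (B f) (B f)"
    using adjoint_norm[OF fg(1)] by (simp flip: L2_norm_power2)
  moreover have "L2_inner M (A g) (A g) = L2_inner M (B g) (B g)"
    using adjoint_norm[OF fg(2)] by (simp flip: L2_norm_power2)
  ultimately show ?thesis
    using fg by (simp add: L2_norm_power2 mem adjoint_mem
        L2_inner_commute[of M "A g" "A f"] L2_inner_commute[of M "B g" "B f"])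
qed

text \<open>Adjoints are closed, and by normality \<open>A\<close> and its adjoint have the same graph norm.\<close>

lemma closed_operator:
  assumes v: "\<And>n::nat. v n \<in> D" and f: "f \<in> L2 M" and y: "y \<in> L2 M"
    and vf: "L2_tendsto M v f sequentially" and vy: "L2_tendsto M (\<lambda>n. A (v n)) y sequentially"
  shows "f \<in> D" "L2_eq M (A f) y"
proof -
  \<comment> \<open>Differences \<open>B (v m) - B (v n)\<close> have the same norm as
    \<open>A (v m) - A (v n)\<close>, so the sequence of adjoint values is Cauchy too.\<close>
  obtain z where z: "z \<in> L2 M" "L2_tendsto M (\<lambda>n. B (v n)) z sequentially"
  proof (rule L2_complete[OF prob adjoint_mem[OF v]])
    fix e :: real assume "e > 0"
    then have "\<forall>\<^sub>F n in sequentially. L2_norm M (\<lambda>x. A (v n) x - y x) < e / 2"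
      using L2_tendstoD[OF vy] by (intro order_tendstoD(2)) auto
    then obtain N where N: "\<And>n. n \<ge> N \<Longrightarrow> L2_norm M (\<lambda>x. A (v n) x - y x) < e / 2"
      by (auto simp: eventually_sequentially)
    have "L2_norm M (\<lambda>x. B (v m) x - B (v n) x) < e" if "m \<ge> N" "n \<ge> N" for m n
    proof -
      have "L2_norm M (\<lambda>x. B (v m) x - B (v n) x) = L2_norm M (\<lambda>x. A (v m) x - A (v n) x)"
        by (rule adjoint_norm_diff[OF v v, symmetric])
      also have "\<dots> \<le> L2_norm M (\<lambda>x. A (v m) x - y x) + L2_norm M (\<lambda>x. y x - A (v n) x)"
        by (rule L2_norm_diff_triangle[OF mem[OF v] y mem[OF v]])
      also have "\<dots> < e"
        using N[OF that(1)] N[OF that(2)] by (simp add: L2_norm_diff_commute[of M y])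
      finally show ?thesis .
    qed
    then show "\<exists>N. \<forall>m\<ge>N. \<forall>n\<ge>N. L2_norm M (\<lambda>x. B (v m) x - B (v n) x) < e"
      by blast
  qed
  \<comment> \<open>Passing to the limit in \<open>(B (v n), g) = (v n, A g)\<close> shows that
    \<open>z\<close> is an adjoint value at \<open>f\<close>, which puts \<open>f\<close> in
    \<open>D\<close>.\<close>
  have "L2_inner M (A g) f = L2_inner M g z" if g: "g \<in> D" for g
  proof -
    have "(\<lambda>n. L2_inner M (v n) (A g)) \<longlonglongrightarrow> L2_inner M f (A g)"
      using f g v by (intro L2_tendsto_inner[OF vf]) (auto simp: dom mem)
    moreover have "(\<lambda>n. L2_inner M (B (v n)) g) \<longlonglongrightarrow> L2_inner M z g"
      using z g v by (intro L2_tendsto_inner[OF z(2)]) (auto simp: dom adjoint_mem)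
    moreover have "L2_inner M (B (v n)) g = L2_inner M (v n) (A g)" for n
      using adjoint[OF v g, of n] by (simp add: L2_inner_commute)
    ultimately have "L2_inner M f (A g) = L2_inner M z g"
      using LIMSEQ_unique by auto
    then show ?thesis by (simp add: L2_inner_commute)
  qed
  with f z have adjv: "is_adjoint_value M D A f z"
    by (simp add: is_adjoint_value_def)
  show fD: "f \<in> D" by (rule adjoint_domI[OF adjv])
  have "L2_tendsto M (\<lambda>n. B (v n)) (B f) sequentially"
    using L2_eq_tendsto[OF z(2) L2_eq_sym[OF adjoint_eqI[OF adjv]]] adjoint_mem[OF v] by simp
  \<comment> \<open>Equality of norms is now used in the reverse direction, to carry convergence
    from \<open>B\<close> back to \<open>A\<close>.\<close>
  then have "L2_tendsto M (\<lambda>n. A (v n)) (A f) sequentially"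
    by (simp add: L2_tendsto_def adjoint_norm_diff[OF v fD])
  then show "L2_eq M (A f) y"
    by (rule L2_tendsto_unique[OF _ vy]) (simp_all add: mem v fD y)
qed

text \<open>\<open>A\<^sup>*\<^sup>* = A\<close>: the graph of \<open>A\<close> is closed, so it contains a point nearest to \<open>(w, z)\<close>, and
  the difference is orthogonal to the graph. The last hypothesis says that \<open>(w, z)\<close> lies in the
  double orthogonal complement of the graph, so the difference vanishes.\<close>

lemma biadjoint:
  assumes w: "w \<in> L2 M" and z: "z \<in> L2 M"
    and wz: "\<And>h. h \<in> D \<Longrightarrow> L2_inner M w (B h) = L2_inner M z h"
  shows "w \<in> D" "L2_eq M (A w) z"
proof -
  \<comment> \<open>\<open>J v\<close> is the squared distance in the product of two copies of L2
    from \<open>(w, z)\<close> to the graph point \<open>(v, A v)\<close>.\<close>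
  define J where "J v = L2_inner M (\<lambda>x. w x - v x) (\<lambda>x. w x - v x)
    + L2_inner M (\<lambda>x. z x - A v x) (\<lambda>x. z x - A v x)" for v
  define m where "m = Inf (J ` D)"
  have J_nonneg: "0 \<le> J v" for v
    by (simp add: J_def)
  have "bdd_below (J ` D)"
    using J_nonneg by (intro bdd_belowI2[of _ 0])
  then have m: "m \<le> J v" if "v \<in> D" for v
    unfolding m_def using that by (intro cInf_lower) auto
  have "D \<noteq> {}"
    using dense[OF w, of 1] by auto
  have "\<exists>v. \<forall>n. v n \<in> D \<and> J (v n) < m + 1 / Suc n"
  proof (rule choice, rule allI)
    fix n
    have "Inf (J ` D) < m + 1 / Suc n" by (simp add: m_def)
    then show "\<exists>v. v \<in> D \<and> J v < m + 1 / Suc n"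
      using cInf_lessD[of "J ` D"] \<open>D \<noteq> {}\<close> by blast
  qed
  then obtain v where vD: "\<And>n. v n \<in> D" and vJ: "\<And>n. J (v n) < m + 1 / Suc n"
    by blast
  \<comment> \<open>The parallelogram law is applied in both components. The midpoint of two graph
    points is again a graph point up to \<open>L2_eq\<close>, so its distance is at least the
    infimum.\<close>
  have para: "(L2_norm M (\<lambda>x. f x - g x))\<^sup>2 + (L2_norm M (\<lambda>x. A f x - A g x))\<^sup>2
      \<le> 2 * J f + 2 * J g - 4 * m" if fg: "f \<in> D" "g \<in> D" for f g
  proof -
    define s where "s = (\<lambda>x. (1/2) * (f x + g x))"
    have sD: "s \<in> D"
      unfolding s_def by (intro dom_scale dom_add fg)
    have "L2_eq M (A s) (\<lambda>x. (1/2) * A (\<lambda>x. f x + g x) x)"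
      unfolding s_def by (intro scale dom_add fg)
    also have "L2_eq M \<dots> (\<lambda>x. (1/2) * (A f x + A g x))"
      by (intro L2_eq_scale add fg)
    finally have "L2_eq M (\<lambda>x. z x - A s x) (\<lambda>x. z x - (1/2) * (A f x + A g x))"
      by (intro L2_eq_diff L2_eq_refl z)
    then have "J s = (L2_norm M (\<lambda>x. w x - (1/2) * (f x + g x)))\<^sup>2
      + (L2_norm M (\<lambda>x. z x - (1/2) * (A f x + A g x)))\<^sup>2"
      using L2_eq_norm[of M "\<lambda>x. z x - A s x"] unfolding J_def L2_norm_power2[symmetric]
      by (simp add: s_def)
    note Js = this
    have "(L2_norm M (\<lambda>x. f x - g x))\<^sup>2 + (L2_norm M (\<lambda>x. A f x - A g x))\<^sup>2
        = 2 * J f + 2 * J g - 4 * J s"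
      unfolding Js L2_parallelogram[OF dom[OF fg(1)] dom[OF fg(2)] w]
        L2_parallelogram[OF mem[OF fg(1)] mem[OF fg(2)] z]
      by (simp add: J_def L2_norm_power2[symmetric] del: L2_norm_scale)
    with m[OF sD] show ?thesis by simp
  qed
  have small: "\<exists>N. \<forall>i\<ge>N. \<forall>j\<ge>N. L2_norm M (\<lambda>x. v i x - v j x) < e
      \<and> L2_norm M (\<lambda>x. A (v i) x - A (v j) x) < e" if e: "e > 0" for e
  proof -
    from e have "0 < e\<^sup>2 / 4" by simp
    \<comment> \<open>Both values of \<open>J\<close> exceed \<open>m\<close> by less than
      \<open>1 / Suc N\<close>, so the bound in \<open>para\<close> is below
      \<open>4 / Suc N\<close>; this explains the 4.\<close>
    then obtain N where N: "1 / Suc N < e\<^sup>2 / 4"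
      using nat_approx_posE by blast
    have "L2_norm M (\<lambda>x. v i x - v j x) < e \<and> L2_norm M (\<lambda>x. A (v i) x - A (v j) x) < e"
      if ij: "i \<ge> N" "j \<ge> N" for i j
    proof -
      have "1 / Suc i \<le> 1 / Suc N" "1 / Suc j \<le> 1 / Suc N"
        using ij by (auto intro!: divide_left_mono)
      then have "(L2_norm M (\<lambda>x. v i x - v j x))\<^sup>2 + (L2_norm M (\<lambda>x. A (v i) x - A (v j) x))\<^sup>2 < e\<^sup>2"
        using para[OF vD vD, of i j] vJ[of i] vJ[of j] N by linarith
      then have "(L2_norm M (\<lambda>x. v i x - v j x))\<^sup>2 < e\<^sup>2"
        "(L2_norm M (\<lambda>x. A (v i) x - A (v j) x))\<^sup>2 < e\<^sup>2"
        using zero_le_power2[of "L2_norm M (\<lambda>x. v i x - v j x)"]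
          zero_le_power2[of "L2_norm M (\<lambda>x. A (v i) x - A (v j) x)"] by linarith+
      with e show ?thesis
        using power_less_imp_less_base[of _ 2 e] by simp
    qed
    then show ?thesis by blast
  qed
  obtain f where f: "f \<in> L2 M" "L2_tendsto M v f sequentially"
  proof (rule L2_complete[OF prob dom[OF vD]])
    fix e :: real assume "e > 0"
    from small[OF this] show "\<exists>N. \<forall>i\<ge>N. \<forall>j\<ge>N. L2_norm M (\<lambda>x. v i x - v j x) < e"
      by blast
  qed
  obtain y where y: "y \<in> L2 M" "L2_tendsto M (\<lambda>n. A (v n)) y sequentially"
  proof (rule L2_complete[OF prob mem[OF vD]])
    fix e :: real assume "e > 0"
    from small[OF this] show "\<exists>N. \<forall>i\<ge>N. \<forall>j\<ge>N. L2_norm M (\<lambda>x. A (v i) x - A (v j) x) < e"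
      by blast
  qed
  have fD: "f \<in> D" and Af: "L2_eq M (A f) y"
    using closed_operator[OF vD f(1) y(1) f(2) y(2)] by auto
  have Av: "L2_tendsto M (\<lambda>n. A (v n)) (A f) sequentially"
    using L2_eq_tendsto[OF y(2) L2_eq_sym[OF Af]] mem[OF vD] by simp
  have "(\<lambda>n. (L2_norm M (\<lambda>x. w x - v n x))\<^sup>2 + (L2_norm M (\<lambda>x. z x - A (v n) x))\<^sup>2)
      \<longlonglongrightarrow> (L2_norm M (\<lambda>x. w x - f x))\<^sup>2 + (L2_norm M (\<lambda>x. z x - A f x))\<^sup>2"
    using w z f vD fD
    by (intro tendsto_add tendsto_power L2_tendsto_norm L2_tendsto_diff L2_tendsto_const Av)
      (auto simp: dom mem)
  then have "(\<lambda>n. J (v n)) \<longlonglongrightarrow> J f"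
    by (simp add: J_def L2_norm_power2)
  moreover have "(\<lambda>n. m + 1 / Suc n) \<longlonglongrightarrow> m + 0"
    using LIMSEQ_inverse_real_of_nat by (intro tendsto_add) (simp_all add: inverse_eq_divide)
  ultimately have "J f \<le> m + 0"
    using vJ by (intro LIMSEQ_le) (auto intro: less_imp_le)
  then have Jf: "J f \<le> J k" if "k \<in> D" for k
    using m[OF that] by simp
  define h where "h = (\<lambda>x. z x - A f x)"
  have h: "h \<in> L2 M"
    unfolding h_def using z fD by (simp add: mem)
  \<comment> \<open>This is the vanishing of the first variation: \<open>J (f - s * k) - J f\<close>
    is a nonnegative quadratic in \<open>s\<close> without constant term, so its linear coefficient
    \<open>b\<close> is 0.\<close>
  have orth: "L2_inner M (\<lambda>x. w x - f x) k + L2_inner M h (A k) = 0" if k: "k \<in> D" for k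
  proof -
    define b where "b = L2_inner M (\<lambda>x. w x - f x) k + L2_inner M h (A k)"
    have "0 \<le> 0 + 2 * s * b + s\<^sup>2 * (L2_inner M k k + L2_inner M (A k) (A k))" for s
    proof -
      define p where "p = (\<lambda>x. f x + (- s) * k x)"
      have pD: "p \<in> D"
        unfolding p_def by (intro dom_add dom_scale fD k)
      have "L2_eq M (A p) (\<lambda>x. A f x + A (\<lambda>x. (- s) * k x) x)"
        unfolding p_def by (intro add dom_scale fD k)
      also have "L2_eq M \<dots> (\<lambda>x. A f x + (- s) * A k x)"
        by (intro L2_eq_add L2_eq_refl scale mem fD k)
      finally have "L2_eq M (\<lambda>x. z x - A p x) (\<lambda>x. z x - (A f x + (- s) * A k x))"
        by (intro L2_eq_diff L2_eq_refl z)
      then have "J p = L2_inner M (\<lambda>x. w x - (f x + (- s) * k x)) (\<lambda>x. w x - (f x + (- s) * k x))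
        + L2_inner M (\<lambda>x. z x - (A f x + (- s) * A k x)) (\<lambda>x. z x - (A f x + (- s) * A k x))"
        using L2_eq_norm[of M "\<lambda>x. z x - A p x"] unfolding J_def L2_norm_power2[symmetric]
        by (simp add: p_def)
      then have "J p = J f + 2 * s * b + s\<^sup>2 * (L2_inner M k k + L2_inner M (A k) (A k))"
        using fD k w z
        by (simp add: J_def b_def h_def dom mem L2_inner_commute[of M k f] L2_inner_commute[of M k w]
            L2_inner_commute[of M "A k" "A f"] L2_inner_commute[of M f w]
            L2_inner_commute[of M "A f" z] L2_inner_commute[of M "A k" z]
            algebra_simps power2_eq_square)
      with Jf[OF pD] show ?thesis by simp
    qed
    then have "b\<^sup>2 \<le> 0 * (L2_inner M k k + L2_inner M (A k) (A k))"
      by (rule quadratic_nonneg_imp_le) simp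
    then show ?thesis by (simp add: b_def)
  qed
  \<comment> \<open>Orthogonality of \<open>(w - f, h)\<close> to the graph is precisely the
    statement that \<open>- (w - f)\<close> is an adjoint value at \<open>h\<close>.\<close>
  have "is_adjoint_value M D A h (\<lambda>x. - (w x - f x))"
    unfolding is_adjoint_value_def
  proof (intro conjI ballI)
    show "(\<lambda>x. - (w x - f x)) \<in> L2 M"
      using w f(1) by (intro L2_uminus L2_diff)
    fix g assume "g \<in> D"
    from orth[OF this] show "L2_inner M (A g) h = L2_inner M g (\<lambda>x. - (w x - f x))"
      unfolding L2_inner_uminus_right by (simp only: L2_inner_commute[of M g] L2_inner_commute[of M "A g"])
  qed (rule h)
  then have hD: "h \<in> D" and Bh: "L2_eq M (B h) (\<lambda>x. - (w x - f x))"
    by (rule adjoint_domI, rule adjoint_eqI)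
  have wf: "(\<lambda>x. w x - f x) \<in> L2 M"
    using w f(1) by simp
  \<comment> \<open>The hypothesis \<open>wz\<close> is tested with \<open>h\<close> itself. Since
    \<open>B h\<close> is \<open>- (w - f)\<close>, it makes the squared norm of \<open>h\<close>
    the negative of that of \<open>w - f\<close>, so both vanish.\<close>
  have "L2_inner M (\<lambda>x. w x - f x) (B h) = L2_inner M z h - L2_inner M (A f) h"
    using wz[OF hD] adjoint[OF hD fD] w f(1) by (simp add: adjoint_mem hD)
  also have "\<dots> = L2_inner M h h"
    using z fD h unfolding h_def by (simp add: mem)
  finally have "L2_inner M h h = - L2_inner M (\<lambda>x. w x - f x) (\<lambda>x. w x - f x)"
    using L2_eq_inner_right[OF Bh wf] unfolding L2_inner_uminus_right by simp
  then have zero: "L2_inner M h h = 0" "L2_inner M (\<lambda>x. w x - f x) (\<lambda>x. w x - f x) = 0"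
    using L2_inner_nonneg[of M h] L2_inner_nonneg[of M "\<lambda>x. w x - f x"] by linarith+
  have wf: "L2_eq M w f"
    using L2_eqI[OF w f(1) zero(2)] .
  show "w \<in> D"
    by (rule dom_cong[OF fD L2_eq_sym[OF wf]])
  have "L2_eq M (A w) (A f)"
    by (rule L2_eq_sym[OF cong[OF fD L2_eq_sym[OF wf]]])
  also have "L2_eq M (A f) z"
    using L2_eqI[OF z mem[OF fD]] zero(1) unfolding h_def by (blast intro: L2_eq_sym)
  finally show "L2_eq M (A w) z" .
qed

text \<open>For \<open>h\<close> in \<open>D\<close> one has
  \<open>(B f, B h) = (A f, A h) = (B (A f), h)\<close>. This is the hypothesis of
  \<open>biadjoint\<close> for \<open>w = B f\<close> and \<open>z = B (A f)\<close>, which gives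
  membership and value at once.\<close>

lemma adjoint_commute:
  assumes f: "f \<in> D" "A f \<in> D"
  shows "B f \<in> D" "L2_eq M (A (B f)) (B (A f))"
proof -
  have "L2_inner M (B f) (B h) = L2_inner M (B (A f)) h" if h: "h \<in> D" for h
    using adjoint_inner[OF f(1) h] adjoint[OF f(2) h] by (simp add: L2_inner_commute)
  then show "B f \<in> D" "L2_eq M (A (B f)) (B (A f))"
    using biadjoint[OF adjoint_mem[OF f(1)] adjoint_mem[OF f(2)]] by auto
qed

end

section \<open>Energies\<close>

text \<open>After normalization to \<open>a 0 = 1\<close> the claim is equivalent to
  \<open>a n ^ (n + 1) <= a (n + 1) ^ n\<close>, which follows from log-convexity by induction
  without logarithms, so zero values cause no trouble.\<close>

lemma root_mono_log_convex:
  fixes E :: "nat \<Rightarrow> real"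
  assumes nonneg: "\<And>n. 0 \<le> E n" and pos: "0 < E 0"
    and convex: "\<And>n. (E (Suc n))\<^sup>2 \<le> E n * E (Suc (Suc n))" and n: "1 \<le> n"
  shows "root n (E n / E 0) \<le> root (n + 1) (E (n + 1) / E 0)"
proof -
  define a where "a n = E n / E 0" for n
  have a0: "a 0 = 1" and a_nonneg: "0 \<le> a n" for n
    using pos nonneg by (auto simp: a_def)
  have a_convex: "(a (Suc n))\<^sup>2 \<le> a n * a (Suc (Suc n))" for n
  proof -
    have "(E (Suc n))\<^sup>2 / (E 0)\<^sup>2 \<le> E n * E (Suc (Suc n)) / (E 0)\<^sup>2"
      using convex by (rule divide_right_mono) simp
    then show ?thesis
      by (simp add: a_def power_divide power2_eq_square)
  qed
  have powers: "a k ^ Suc k \<le> a (Suc k) ^ k" for k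
  proof (induction k)
    case 0
    show ?case by (simp add: a0)
  next
    case (Suc k)
    show ?case
    proof (cases "a (Suc k) = 0")
      case True
      then show ?thesis using a_nonneg by simp
    next
      case False
      then have p: "0 < a (Suc k) ^ k"
        using a_nonneg[of "Suc k"] by simp
      \<comment> \<open>The target is multiplied by \<open>a (Suc k) ^ k\<close>: the left side
        becomes a power of the square that log-convexity bounds, and the induction hypothesis
        restores the same factor on the right for cancellation.\<close>
      have "a (Suc k) ^ k * a (Suc k) ^ Suc (Suc k) = ((a (Suc k))\<^sup>2) ^ Suc k"
        by (simp add: power_even_eq power_mult_distrib power2_eq_square mult_ac flip: power_add power_mult)
      also have "\<dots> \<le> (a k * a (Suc (Suc k))) ^ Suc k"
        by (intro power_mono a_convex) simp
      also have "\<dots> = a k ^ Suc k * a (Suc (Suc k)) ^ Suc k"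
        by (rule power_mult_distrib)
      also have "\<dots> \<le> a (Suc k) ^ k * a (Suc (Suc k)) ^ Suc k"
        using Suc a_nonneg by (intro mult_right_mono) simp_all
      finally show ?thesis
        using p by (simp only: mult_le_cancel_left_pos)
    qed
  qed
  define r where "r = root n (a n)"
  have r: "0 \<le> r" "r ^ n = a n"
    using n a_nonneg by (simp_all add: r_def)
  have "(r ^ Suc n) ^ n = a n ^ Suc n"
    unfolding r(2)[symmetric] by (simp only: power_mult[symmetric] mult.commute)
  with powers[of n] have "(r ^ Suc n) ^ n \<le> a (Suc n) ^ n" by simp
  moreover obtain k where "n = Suc k"
    using n by (cases n) auto
  ultimately have "r ^ Suc n \<le> a (Suc n)"
    using a_nonneg power_le_imp_le_base[of "r ^ Suc n" k "a (Suc n)"] by simp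
  then have "root (Suc n) (r ^ Suc n) \<le> root (Suc n) (a (Suc n))"
    by (intro real_root_le_mono) simp_all
  then have "r \<le> root (Suc n) (a (Suc n))"
    using r(1) real_root_power_cancel[of "Suc n" r] by (simp del: power_Suc)
  then show ?thesis
    by (simp add: r_def a_def)
qed

text \<open>These are the facts about a Markov generator that the energies see: dissipativity gives
  the sign of \<open>E 1\<close>, and the conditions on the constant 1 remove the products of
  means.\<close>

locale normal_generator = normal_L2_operator +
  assumes dissipative: "\<And>f. f \<in> D \<Longrightarrow> L2_inner M (A f) f \<le> 0"
    and integral_zero: "\<And>f. f \<in> D \<Longrightarrow> L2_inner M (A f) (\<lambda>x. 1) = 0"
    and one_dom: "(\<lambda>x. 1) \<in> D"
    and one: "L2_eq M (A (\<lambda>x. 1)) (\<lambda>x. 0)"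
begin

section \<open>Smooth vectors and their stability under \<open>A\<close> and its adjoint\<close>

lemma dom_pow_cong: "f \<in> dom_pow M D A n \<Longrightarrow> L2_eq M f g \<Longrightarrow> g \<in> dom_pow M D A n"
proof (induction n arbitrary: f g)
  case 0
  then show ?case by (simp add: L2_eq_mem)
next
  case (Suc n)
  then have f: "f \<in> D" "A f \<in> dom_pow M D A n" by simp_all
  show ?case
    using Suc.IH[OF f(2) cong[OF f(1) Suc.prems(2)]] dom_cong[OF f(1) Suc.prems(2)] by simp
qed

lemma dom_pow_add:
  "f \<in> dom_pow M D A n \<Longrightarrow> g \<in> dom_pow M D A n \<Longrightarrow> (\<lambda>x. f x + g x) \<in> dom_pow M D A n"
proof (induction n arbitrary: f g)
  case (Suc n)
  then have fg: "f \<in> D" "g \<in> D" and "(\<lambda>x. A f x + A g x) \<in> dom_pow M D A n" by simp_all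
  from dom_pow_cong[OF this(3) L2_eq_sym[OF add[OF fg]]] show ?case
    by (simp add: dom_add fg)
qed simp

lemma dom_pow_scale: "f \<in> dom_pow M D A n \<Longrightarrow> (\<lambda>x. c * f x) \<in> dom_pow M D A n"
proof (induction n arbitrary: f)
  case (Suc n)
  then have f: "f \<in> D" and "(\<lambda>x. c * A f x) \<in> dom_pow M D A n" by simp_all
  from dom_pow_cong[OF this(2) L2_eq_sym[OF scale[OF f]]] show ?case
    by (simp add: dom_scale f)
qed simp

text \<open>Commutation replaces \<open>A (B f)\<close> by \<open>B (A f)\<close>, to which the
  induction hypothesis applies. One power of the domain is lost, which is harmless in the
  intersection of all of them.\<close>

lemma dom_pow_adjoint: "f \<in> dom_pow M D A (Suc n) \<Longrightarrow> B f \<in> dom_pow M D A n"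
proof (induction n arbitrary: f)
  case 0
  then show ?case by (simp add: adjoint_mem)
next
  case (Suc n)
  then have f: "f \<in> D" "A f \<in> D" and "B (A f) \<in> dom_pow M D A n" by simp_all
  from dom_pow_cong[OF this(3) L2_eq_sym[OF adjoint_commute(2)[OF f]]] show ?case
    by (simp add: adjoint_commute f)
qed

abbreviation "Dinf \<equiv> dom_infty M D A"

lemma Dinf_iff: "f \<in> Dinf \<longleftrightarrow> (\<forall>n. f \<in> dom_pow M D A n)"
  by (simp add: dom_infty_def)

lemma Dinf_dom: "f \<in> Dinf \<Longrightarrow> f \<in> D"
  unfolding Dinf_iff using dom_pow.simps(2)[of M D A 0] by blast

lemma Dinf_L2: "f \<in> Dinf \<Longrightarrow> f \<in> L2 M"
  using Dinf_dom dom by blast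

lemma Dinf_A: "f \<in> Dinf \<Longrightarrow> A f \<in> Dinf"
  unfolding Dinf_iff by (metis (no_types, lifting) dom_pow.simps(2) mem_Collect_eq)

lemma Dinf_B: "f \<in> Dinf \<Longrightarrow> B f \<in> Dinf"
  unfolding Dinf_iff using dom_pow_adjoint by blast

lemma Dinf_add: "f \<in> Dinf \<Longrightarrow> g \<in> Dinf \<Longrightarrow> (\<lambda>x. f x + g x) \<in> Dinf"
  unfolding Dinf_iff using dom_pow_add by blast

lemma Dinf_scale: "f \<in> Dinf \<Longrightarrow> (\<lambda>x. c * f x) \<in> Dinf"
  unfolding Dinf_iff using dom_pow_scale by blast

section \<open>The energies as symmetric positive forms\<close>

abbreviation "e \<equiv> energy M A"

lemma energy_sym: "e n f h = e n h f"
proof (induction n arbitrary: f h)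
  case 0
  show ?case by (simp add: L2_inner_commute[of M f h])
next
  case (Suc n)
  show ?case
    using Suc[of "A f" h] Suc[of f "A h"] by simp
qed

text \<open>This absorbs the choice of representatives: values such as \<open>A\<close> of a sum are
  known only up to \<open>L2_eq\<close>, and the energies do not see the difference.\<close>

lemma energy_cong:
  "f \<in> Dinf \<Longrightarrow> h \<in> Dinf \<Longrightarrow> L2_eq M f g \<Longrightarrow> e n f h = e n g h"
proof (induction n arbitrary: f g h)
  case 0
  then show ?case
    using L2_eq_inner_left[OF 0(3)] Dinf_L2[OF 0(2)] L2_const[OF prob] by simp
next
  case (Suc n)
  show ?case
    using Suc.IH[OF Dinf_A[OF Suc.prems(1)] Suc.prems(2) cong[OF Dinf_dom[OF Suc.prems(1)] Suc.prems(3)]]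
      Suc.IH[OF Suc.prems(1) Dinf_A[OF Suc.prems(2)] Suc.prems(3)]
    by simp
qed

lemma energy_add:
  "f \<in> Dinf \<Longrightarrow> g \<in> Dinf \<Longrightarrow> h \<in> Dinf \<Longrightarrow> e n (\<lambda>x. f x + g x) h = e n f h + e n g h"
proof (induction n arbitrary: f g h)
  case 0
  then show ?case
    using L2_const[OF prob] by (simp add: Dinf_L2 distrib_right)
next
  case (Suc n)
  note D = Suc.prems
  have "e n (A (\<lambda>x. f x + g x)) h = e n (\<lambda>x. A f x + A g x) h"
    by (rule energy_cong[OF Dinf_A[OF Dinf_add[OF D(1,2)]] D(3) add[OF D(1,2)[THEN Dinf_dom]]])
  then show ?case
    using Suc.IH[OF Dinf_A[OF D(1)] Dinf_A[OF D(2)] D(3)] Suc.IH[OF D(1,2) Dinf_A[OF D(3)]]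
    by simp
qed

lemma energy_scale:
  "f \<in> Dinf \<Longrightarrow> h \<in> Dinf \<Longrightarrow> e n (\<lambda>x. c * f x) h = c * e n f h"
proof (induction n arbitrary: f h)
  case 0
  then show ?case by (simp add: right_diff_distrib)
next
  case (Suc n)
  note D = Suc.prems
  have "e n (A (\<lambda>x. c * f x)) h = e n (\<lambda>x. c * A f x) h"
    by (rule energy_cong[OF Dinf_A[OF Dinf_scale[OF D(1)]] D(2) scale[OF Dinf_dom[OF D(1)]]])
  then show ?case
    using Suc.IH[OF Dinf_A[OF D(1)] D(2)] Suc.IH[OF D(1) Dinf_A[OF D(2)]]
    by (simp add: right_diff_distrib)
qed

text \<open>Moving the adjoint to the other side gives \<open>(1, B f) = (A 1, f)\<close>, and
  \<open>A 1\<close> vanishes.\<close>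

lemma adjoint_integral_zero:
  assumes "f \<in> D"
  shows "L2_inner M (B f) (\<lambda>x. 1) = 0"
proof -
  have "L2_inner M (\<lambda>x. 1) (B f) = L2_inner M (\<lambda>x. 0) f"
    using adjoint[OF assms one_dom] L2_eq_inner_left[OF one dom[OF assms]] by simp
  also have "\<dots> = 0"
    by (simp add: L2_inner_def)
  finally show ?thesis
    by (simp add: L2_inner_commute)
qed

text \<open>For \<open>n = 0\<close> the products of means vanish on both sides, leaving the adjoint
  relation for the scalar product. In the induction step the two recursions match once
  \<open>A (B f)\<close> is exchanged with \<open>B (A f)\<close>.\<close>

lemma energy_adjoint:
  "f \<in> Dinf \<Longrightarrow> h \<in> Dinf \<Longrightarrow> e n f (A h) = e n (B f) h"
proof (induction n arbitrary: f h)
  case 0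
  then have D: "f \<in> D" "h \<in> D" by (simp_all add: Dinf_dom)
  show ?case
    using adjoint[OF D] integral_zero[OF D(2)] adjoint_integral_zero[OF D(1)]
    by (simp add: L2_inner_commute)
next
  case (Suc n)
  note D = Suc.prems
  have "e n (A (B f)) h = e n (B (A f)) h"
    using D adjoint_commute(2)[of f]
    by (intro energy_cong) (simp_all add: Dinf_A Dinf_B Dinf_dom)
  then show ?case
    using Suc.IH[OF Dinf_A[OF D(1)] D(2)] Suc.IH[OF D(1) Dinf_A[OF D(2)]] by simp
qed

definition "G f = (\<lambda>x. -1 * (A f x + B f x))" for f

lemma Dinf_G: "f \<in> Dinf \<Longrightarrow> G f \<in> Dinf"
  unfolding G_def by (intro Dinf_scale Dinf_add Dinf_A Dinf_B)

lemma energy_Suc: "f \<in> Dinf \<Longrightarrow> h \<in> Dinf \<Longrightarrow> e (Suc n) f h = e n (G f) h"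
  unfolding G_def
  by (subst energy_scale) (simp_all add: energy_add energy_adjoint Dinf_add Dinf_A Dinf_B)

text \<open>The first reduction turns the left argument into \<open>G f\<close>; symmetry exposes
  the remaining plain \<open>f\<close> to the second one.\<close>

lemma energy_Suc_Suc:
  assumes "f \<in> Dinf"
  shows "e (Suc (Suc n)) f f = e n (G f) (G f)"
  using energy_Suc[OF assms assms, of "Suc n"] energy_Suc[OF assms Dinf_G[OF assms], of n]
    energy_sym[of "Suc n" f "G f"] by simp

lemma energy_nonneg: "f \<in> Dinf \<Longrightarrow> 0 \<le> e n f f"
proof (induction n arbitrary: f rule: induct_nat_012)
  case (0 f)
  have one: "(\<lambda>x. 1) \<in> L2 M" by (rule L2_const[OF prob])
  \<comment> \<open>The variance is nonnegative by Cauchy-Schwarz against the constant 1 of norm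
    1.\<close>
  have "\<bar>L2_inner M f (\<lambda>x. 1)\<bar> \<le> L2_norm M f"
    using L2_Cauchy_Schwarz[OF Dinf_L2[OF 0] one] L2_norm_const[OF prob, of 1] by simp
  then have "\<bar>L2_inner M f (\<lambda>x. 1)\<bar>\<^sup>2 \<le> (L2_norm M f)\<^sup>2"
    by (rule power_mono) simp
  then show ?case by (simp add: L2_norm_power2 flip: power2_eq_square)
next
  case (1 f)
  then have f: "f \<in> D" by (rule Dinf_dom)
  then show ?case
    using dissipative[OF f] integral_zero[OF f] by (simp add: L2_inner_commute[of M f "A f"])
next
  case (ge2 n f)
  then show ?case
    using energy_Suc_Suc[of f n] Dinf_G[of f] by metis
qed

lemma energy_Cauchy_Schwarz:
  assumes f: "f \<in> Dinf" and h: "h \<in> Dinf"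
  shows "(e n f h)\<^sup>2 \<le> e n f f * e n h h"
proof (rule quadratic_nonneg_imp_le)
  fix s :: real
  define p where "p = (\<lambda>x. f x + s * h x)"
  have p: "p \<in> Dinf"
    unfolding p_def by (intro Dinf_add Dinf_scale f h)
  have left: "e n p k = e n f k + s * e n h k" if "k \<in> Dinf" for k
    unfolding p_def using f h that by (simp add: energy_add energy_scale Dinf_scale)
  have "e n p p = e n f p + s * e n h p"
    by (rule left[OF p])
  also have "\<dots> = (e n f f + s * e n h f) + s * (e n f h + s * e n h h)"
    unfolding energy_sym[of n f p] energy_sym[of n h p] left[OF f] left[OF h] ..
  also have "\<dots> = e n f f + 2 * s * e n f h + s\<^sup>2 * e n h h"
    by (simp add: energy_sym[of n h f] power2_eq_square algebra_simps)
  finally show "0 \<le> e n f f + 2 * s * e n f h + s\<^sup>2 * e n h h"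
    using energy_nonneg[OF p, of n] by simp
qed (rule energy_nonneg[OF h])

lemma energy_log_convex:
  assumes "f \<in> Dinf"
  shows "(e (Suc n) f f)\<^sup>2 \<le> e n f f * e (Suc (Suc n)) f f"
  using energy_Cauchy_Schwarz[OF assms Dinf_G[OF assms], of n]
  unfolding energy_Suc_Suc[OF assms] energy_Suc[OF assms assms, of n] energy_sym[of n f "G f"] .

end

section \<open>The generator of a Markov semigroup\<close>

context
  fixes T :: "real \<Rightarrow> (('z::topological_space \<Rightarrow>\<^sub>C real) \<Rightarrow>\<^sub>L ('z \<Rightarrow>\<^sub>C real))" and M :: "'z measure"
  assumes metr: "metrizable_space (euclidean :: 'z topology)"
    and T: "markov_semigroup T" and stat: "stationary_prob T M"
begin

lemma stationary_measure: "prob_space M" "sets M = sets borel"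
  using stat by (simp_all add: stationary_prob_def)

lemma semigroup_markov: "0 \<le> t \<Longrightarrow> markov_operator (T t)"
  using T by (simp add: markov_semigroup_def)

lemma semigroup_invariant:
  "0 \<le> t \<Longrightarrow> (\<integral>x. apply_bcontfun (blinfun_apply (T t) g) x \<partial>M) = (\<integral>x. apply_bcontfun g x \<partial>M)"
  using stat by (simp add: stationary_prob_def)

lemma semigroup_extension:
  "0 < t \<Longrightarrow> f \<in> L2 M \<Longrightarrow> L2_extends M (T t) f (L2_extension M (T t) f)"
  using stationary_measure metr semigroup_markov semigroup_invariant
  by (intro L2_extension) auto

lemma semigroup_extends_unique:
  assumes "0 < t" "L2_extends M (T t) f h" "L2_extends M (T t) g k" "L2_eq M f g"
  shows "L2_eq M h k"
  using assms(1) by (intro L2_extends_unique[OF stationary_measure metr _ _ assms(2-4)]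
      semigroup_markov semigroup_invariant) auto

text \<open>Each algebraic rule is proved for the relation \<open>L2_extends\<close>, and uniqueness
  identifies the result with the chosen representative up to \<open>L2_eq\<close>.\<close>

lemma semigroup_contractions: "L2_contractions M (\<lambda>t. L2_extension M (T t))"
proof (rule L2_contractions.intro)
  show "prob_space M" by (rule stationary_measure)
next
  fix t :: real and f assume t: "0 < t" and f: "f \<in> L2 M"
  note ext = semigroup_extension[OF t f]
  show "L2_extension M (T t) f \<in> L2 M"
    using ext by (simp add: L2_extends_def)
  show "L2_norm M (L2_extension M (T t) f) \<le> L2_norm M f"
    using t by (intro L2_extends_norm_le[OF stationary_measure metr _ _ ext]
      semigroup_markov semigroup_invariant) auto
  show "L2_inner M (L2_extension M (T t) f) (\<lambda>x. 1) = L2_inner M f (\<lambda>x. 1)"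
    using t by (intro L2_extends_integral[OF stationary_measure metr _ _ ext]
      semigroup_markov semigroup_invariant) auto
  fix c :: real
  have "L2_extends M (T t) (\<lambda>x. c * f x) (\<lambda>x. c * L2_extension M (T t) f x)"
    using t by (intro L2_extends_scale[OF stationary_measure metr _ _ ext]
      semigroup_markov semigroup_invariant) auto
  from semigroup_extends_unique[OF t semigroup_extension[OF t] this] f
  show "L2_eq M (L2_extension M (T t) (\<lambda>x. c * f x)) (\<lambda>x. c * L2_extension M (T t) f x)"
    by simp
next
  fix t :: real and f g assume t: "0 < t" and f: "f \<in> L2 M" and g: "g \<in> L2 M"
  have "L2_extends M (T t) (\<lambda>x. f x + g x) (\<lambda>x. L2_extension M (T t) f x + L2_extension M (T t) g x)"
    using t by (intro L2_extends_add[OF stationary_measure metr _ _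
        semigroup_extension[OF t f] semigroup_extension[OF t g]]
      semigroup_markov semigroup_invariant) auto
  from semigroup_extends_unique[OF t semigroup_extension[OF t] this] f g
  show "L2_eq M (L2_extension M (T t) (\<lambda>x. f x + g x))
      (\<lambda>x. L2_extension M (T t) f x + L2_extension M (T t) g x)"
    by simp
next
  fix t :: real and f g assume t: "0 < t" and fg: "L2_eq M f g"
  show "L2_eq M (L2_extension M (T t) f) (L2_extension M (T t) g)"
    by (rule semigroup_extends_unique[OF t semigroup_extension[OF t] semigroup_extension[OF t] fg])
      (use L2_eq_mem[OF fg] in simp_all)
next
  fix t :: real assume t: "0 < t"
  have one: "(\<lambda>x. 1) \<in> L2 M" by (rule L2_const[OF stationary_measure(1)])
  have "L2_extends M (T t) (apply_bcontfun (const_bcontfun 1))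
      (apply_bcontfun (blinfun_apply (T t) (const_bcontfun 1)))"
    using t by (intro L2_extends_continuous[OF stationary_measure metr]
      semigroup_markov semigroup_invariant) auto
  moreover have "blinfun_apply (T t) (const_bcontfun 1) = const_bcontfun 1"
    using semigroup_markov[of t] t by (simp add: markov_operator_def)
  ultimately have "L2_extends M (T t) (\<lambda>x. 1) (\<lambda>x. 1)"
    by (simp add: const_bcontfun.rep_eq)
  from semigroup_extends_unique[OF t semigroup_extension[OF t one] this L2_eq_refl[OF one]]
  show "L2_eq M (L2_extension M (T t) (\<lambda>x. 1)) (\<lambda>x. 1)" .
qed

interpretation L2_contractions M "\<lambda>t. L2_extension M (T t)"
  by (rule semigroup_contractions)

lemma semigroup_extension_continuous:
  assumes t: "0 < t"
  shows "L2_eq M (L2_extension M (T t) (apply_bcontfun u)) (apply_bcontfun (blinfun_apply (T t) u))"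
proof -
  have u: "apply_bcontfun u \<in> L2 M" by (rule continuous_L2[OF stationary_measure])
  have "L2_extends M (T t) (apply_bcontfun u) (apply_bcontfun (blinfun_apply (T t) u))"
    using t by (intro L2_extends_continuous[OF stationary_measure metr]
      semigroup_markov semigroup_invariant) auto
  from semigroup_extends_unique[OF t semigroup_extension[OF t u] this L2_eq_refl[OF u]]
  show ?thesis .
qed

lemma L2_tendsto_continuous:
  fixes u :: "'b \<Rightarrow> 'z \<Rightarrow>\<^sub>C real"
  assumes "(u \<longlongrightarrow> l) F"
  shows "L2_tendsto M (\<lambda>b. apply_bcontfun (u b)) (apply_bcontfun l) F"
proof (rule L2_tendsto_bound)
  show "((\<lambda>b. norm (u b - l)) \<longlongrightarrow> 0) F"
    using assms by (simp add: tendsto_norm_zero LIM_zero)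
  show "\<forall>\<^sub>F b in F. L2_norm M (\<lambda>x. apply_bcontfun (u b) x - apply_bcontfun l x) \<le> norm (u b - l)"
    using L2_norm_continuous_le[OF stationary_measure, of "u _ - l"]
    by (intro always_eventually allI) simp
qed

lemma orbit_integral_generator_value:
  assumes "0 \<le> a"
  shows "is_generator_value M (\<lambda>t. L2_extension M (T t)) (apply_bcontfun (orbit_integral T u a))
    (apply_bcontfun (blinfun_apply (T a) u - u))"
  unfolding is_generator_value_def
proof (intro conjI)
  let ?F = "orbit_integral T u a"
  show "L2_tendsto M (\<lambda>t x. (L2_extension M (T t) (apply_bcontfun ?F) x - apply_bcontfun ?F x) / t)
      (apply_bcontfun (blinfun_apply (T a) u - u)) (at_right 0)"
  proof (rule L2_tendsto_cong[OF L2_tendsto_continuous[OF orbit_integral_generator[OF T assms]]])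
    show "\<forall>\<^sub>F t in at_right 0. L2_eq M (apply_bcontfun ((blinfun_apply (T t) ?F - ?F) /\<^sub>R t))
        (\<lambda>x. (L2_extension M (T t) (apply_bcontfun ?F) x - apply_bcontfun ?F x) / t)"
      using eventually_pos
    proof eventually_elim
      case (elim t)
      have "L2_eq M (\<lambda>x. (apply_bcontfun (blinfun_apply (T t) ?F) x - apply_bcontfun ?F x) / t)
          (\<lambda>x. (L2_extension M (T t) (apply_bcontfun ?F) x - apply_bcontfun ?F x) / t)"
        by (intro L2_eq_divide L2_eq_diff L2_eq_refl continuous_L2[OF stationary_measure]
            L2_eq_sym[OF semigroup_extension_continuous[OF elim]])
      then show ?case
        by (simp add: divide_inverse mult.commute)
    qed
  qed (rule L2_eq_refl[OF continuous_L2[OF stationary_measure]])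
qed (rule continuous_L2[OF stationary_measure])+

text \<open>Half of \<open>e\<close> is spent on a continuous \<open>u\<close> near
  \<open>f\<close>, the other half on the average of the orbit of \<open>u\<close> over a short time
  \<open>h\<close>. That average is in the domain as a multiple of an orbit integral.\<close>

lemma generator_dom_dense:
  assumes f: "f \<in> L2 M" and e: "0 < e"
  shows "\<exists>g\<in>generator_dom M (\<lambda>t. L2_extension M (T t)). L2_norm M (\<lambda>x. f x - g x) < e"
proof -
  from e have e2: "0 < e / 2" by simp
  from cont_approxD[OF cont_approx_L2[OF stationary_measure metr f] this]
  obtain u :: "'z \<Rightarrow>\<^sub>C real" where u: "L2_norm M (\<lambda>x. f x - apply_bcontfun u x) < e / 2"
    by blast
  have "L2_tendsto M (\<lambda>h. apply_bcontfun (orbit_integral T u h /\<^sub>R h)) (apply_bcontfun u) (at_right 0)"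
    by (rule L2_tendsto_continuous[OF orbit_integral_average[OF T]])
  from order_tendstoD(2)[OF L2_tendstoD[OF this] e2] eventually_pos
  have "\<forall>\<^sub>F h in at_right 0. 0 < h \<and>
      L2_norm M (\<lambda>x. apply_bcontfun (orbit_integral T u h /\<^sub>R h) x - apply_bcontfun u x) < e / 2"
    by eventually_elim simp
  then obtain h where h: "0 < h"
      "L2_norm M (\<lambda>x. apply_bcontfun (orbit_integral T u h /\<^sub>R h) x - apply_bcontfun u x) < e / 2"
    using eventually_happens'[OF trivial_limit_at_right_real] by blast
  let ?v = "orbit_integral T u h /\<^sub>R h"
  have "is_generator_value M (\<lambda>t. L2_extension M (T t)) (\<lambda>x. inverse h * apply_bcontfun (orbit_integral T u h) x)
      (\<lambda>x. inverse h * apply_bcontfun (blinfun_apply (T h) u - u) x)"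
    using h(1) by (intro generator_value_scale orbit_integral_generator_value) simp
  then have "apply_bcontfun ?v \<in> generator_dom M (\<lambda>t. L2_extension M (T t))"
    using generator_domI by simp
  moreover have "L2_norm M (\<lambda>x. f x - apply_bcontfun ?v x) < e"
  proof -
    have "L2_norm M (\<lambda>x. f x - apply_bcontfun ?v x) \<le> L2_norm M (\<lambda>x. f x - apply_bcontfun u x)
        + L2_norm M (\<lambda>x. apply_bcontfun u x - apply_bcontfun ?v x)"
      by (rule L2_norm_diff_triangle[OF f]) (rule continuous_L2[OF stationary_measure])+
    with u h(2) show ?thesis
      by (simp only: L2_norm_diff_commute[of M "apply_bcontfun u"])
  qed
  ultimately show ?thesis by blast
qed

lemma semigroup_normal_generator:
  assumes "normal_op M (generator_dom M (\<lambda>t. L2_extension M (T t))) (generator M (\<lambda>t. L2_extension M (T t)))"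
  shows "normal_generator M (generator_dom M (\<lambda>t. L2_extension M (T t))) (generator M (\<lambda>t. L2_extension M (T t)))"
proof (intro normal_generator.intro normal_L2_operator.intro
    normal_L2_operator_axioms.intro normal_generator_axioms.intro)
  show "L2_operator M (generator_dom M (\<lambda>t. L2_extension M (T t))) (generator M (\<lambda>t. L2_extension M (T t)))"
    by (rule generator_L2_operator[OF generator_dom_dense])
  show "(\<lambda>x. 1) \<in> generator_dom M (\<lambda>t. L2_extension M (T t))"
    by (rule generator_domI[OF generator_value_one])
  show "L2_eq M (generator M (\<lambda>t. L2_extension M (T t)) (\<lambda>x. 1)) (\<lambda>x. 0)"
    by (rule generator_eqI[OF generator_value_one])
next
  fix f assume "f \<in> generator_dom M (\<lambda>t. L2_extension M (T t))"
  note gv = generator_value[OF this]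
  show "L2_inner M (generator M (\<lambda>t. L2_extension M (T t)) f) f \<le> 0"
    by (rule generator_value_dissipative[OF gv])
  show "L2_inner M (generator M (\<lambda>t. L2_extension M (T t)) f) (\<lambda>x. 1) = 0"
    by (rule generator_value_integral[OF gv])
qed (rule assms)

end

theorem proposition3p3:
  fixes T :: "real \<Rightarrow> (('z::topological_space \<Rightarrow>\<^sub>C real) \<Rightarrow>\<^sub>L ('z \<Rightarrow>\<^sub>C real))"
    and \<mu> :: "'z measure"
    and S :: "real \<Rightarrow> ('z \<Rightarrow> real) \<Rightarrow> ('z \<Rightarrow> real)"
    and A :: "('z \<Rightarrow> real) \<Rightarrow> ('z \<Rightarrow> real)"
    and D :: "('z \<Rightarrow> real) set"
    and g :: "'z \<Rightarrow> real"
    and E :: "nat \<Rightarrow> real"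
  assumes compact: "compact (UNIV :: 'z set)"
    and metrizable: "metrizable_space (euclidean :: 'z topology)"
    and semigroup: "markov_semigroup T"
    and stationary: "stationary_prob T \<mu>"
  defines "S \<equiv> \<lambda>t. L2_extension \<mu> (T t)"
    and "A \<equiv> generator \<mu> S"
    and "D \<equiv> generator_dom \<mu> S"
    and "E \<equiv> \<lambda>n. energy \<mu> A n g g"
  assumes normal: "normal_op \<mu> D A"
    and g: "g \<in> dom_infty \<mu> D A"
  shows "(\<forall>n\<ge>1. E (n + 1) * E (n - 1) \<ge> (E n)\<^sup>2) \<and>
         (E 0 > 0 \<longrightarrow>
           (\<forall>n\<ge>1. root (n + 1) (E (n + 1) / E 0) \<ge> root n (E n / E 0)))"
proof -
  interpret normal_generator \<mu> D A
    using semigroup_normal_generator[OF metrizable semigroup stationary] normal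
    unfolding D_def A_def S_def .
  have nonneg: "0 \<le> E n" for n
    unfolding E_def by (rule energy_nonneg[OF g])
  have convex: "(E (Suc n))\<^sup>2 \<le> E n * E (Suc (Suc n))" for n
    unfolding E_def by (rule energy_log_convex[OF g])
  show ?thesis
  proof (intro conjI impI allI)
    fix n :: nat assume "1 \<le> n"
    \<comment> \<open>Since \<open>n\<close> is at least 1, writing it as a successor removes the
      truncated subtraction in \<open>n - 1\<close>.\<close>
    then obtain k where "n = Suc k" by (cases n) auto
    then show "(E n)\<^sup>2 \<le> E (n + 1) * E (n - 1)"
      using convex[of k] by (simp add: mult.commute)
  next
    fix n :: nat assume "0 < E 0" "1 \<le> n"
    then show "root n (E n / E 0) \<le> root (n + 1) (E (n + 1) / E 0)"
      by (rule root_mono_log_convex[of E n, OF nonneg _ convex])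
  qed
qed

end
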